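(* Let $\Gamma$ be a represented pointclass satisfying the standing assumptions. Then $\mathrm{SPE}_\Gamma\leq_W\widehat{\mathrm{Win}_\Gamma}\times\widehat{\mathrm{Det}_\Gamma}$.
   Context: $f\leq_W g$ iff there are computable partial $K,H$ on $\mathbb{N}^\mathbb{N}$ such that for every realizer $G$ of $g$, $p\mapsto K(\langle p,G(H(p))\rangle)$ realizes $f$. $f\times g$ is the product, $\widehat{f}(x_0,x_1,\ldots)=(f(x_0),f(x_1),\ldots)$. Games: an infinite sequential game (choices $\{0,1\}$) has players $A$, turn function $d:\{0,1\}^*\to A$, outcomes $O$, valuation $v:\{0,1\}^\mathbb{N}\to O$, preferences $\prec_a$ on $O$ with well-founded inverses. Strategy profile $s:\{0,1\}^*\to\{0,1\}$; play induced from history $\lambda$: $p_n=\lambda_n$ for $n<|\lambda|$, $p_n=s(p_{<n})$ otherwise. Nash equilibrium: no player can by changing only its own strategy reach a strictly preferred outcome. Subgame perfect equilibrium: a profile that is a Nash equilibrium of the game started at every history $\lambda$ (outcomes taken of plays induced from $\lambda$). A game is named by numbers of players/outcomes, $d$ and preferences as lookup tables, and for each player $a$ and upper set $U$ of outcomes w.r.t. $\prec_a$ a $\Gamma$-name of $v^{-1}(U)$. Win/lose games: two players, outcomes $w_1,w_2$, player $i$ prefers $w_i$. $\mathrm{Det}_\Gamma$: input a win/lose game with player-1 winning set given by a $\Gamma$-name; output a Nash equilibrium. $\mathrm{Win}_\Gamma$: same input, output who has a winning strategy. $\mathrm{SPE}_\Gamma$: input a two-player game with finitely many outcomes and antagonistic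 linear preferences ($\prec_1=\prec_2^{-1}$); output a subgame perfect equilibrium. Standing assumptions on $\Gamma$: win/lose games with player-1 winning set in $\Gamma$ are determined; $\emptyset,\{0,1\}^\mathbb{N}\in\Gamma$; uniformly computable closure under rescaling $(w,A)\mapsto\{wp\mid p\in A\}$ and its inverse, and under intersection with clopens. *)

theory Defs
  imports Main "HOL-Library.Nat_Bijection"
begin

type_synonym baire = "nat \<Rightarrow> nat"
type_synonym cantor = "nat \<Rightarrow> bool"

text \<open>Codes of partial mu-recursive functions relative to an oracle.\<close>
datatype rf = Zr | Sc | Pj nat | Orc | Cn rf "rf list" | Pr rf rf | Mn rf

definition arg :: "nat \<Rightarrow> nat list \<Rightarrow> nat" where
  "arg i xs = (if i < length xs then xs ! i else 0)"

inductive ev :: "baire \<Rightarrow> rf \<Rightarrow> nat list \<Rightarrow> nat \<Rightarrow> bool" for p where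
  ev_Zr: "ev p Zr xs 0"
| ev_Sc: "ev p Sc xs (Suc (arg 0 xs))"
| ev_Pj: "ev p (Pj i) xs (arg i xs)"
| ev_Orc: "ev p Orc xs (p (arg 0 xs))"
| ev_Cn: "length ys = length gs \<Longrightarrow> (\<forall>i<length gs. ev p (gs ! i) xs (ys ! i))
           \<Longrightarrow> ev p f ys v \<Longrightarrow> ev p (Cn f gs) xs v"
| ev_Pr0: "ev p f xs v \<Longrightarrow> ev p (Pr f g) (0 # xs) v"
| ev_PrS: "ev p (Pr f g) (n # xs) u \<Longrightarrow> ev p g (n # u # xs) v \<Longrightarrow> ev p (Pr f g) (Suc n # xs) v"
| ev_Mn: "ev p f (n # xs) 0 \<Longrightarrow> (\<forall>m<n. \<exists>u. ev p f (m # xs) (Suc u)) \<Longrightarrow> ev p (Mn f) xs n"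

definition comp_fun :: "rf \<Rightarrow> baire \<Rightarrow> baire \<Rightarrow> bool" where
  "comp_fun e p q \<longleftrightarrow> (\<forall>n. ev p e [n] (q n))"

definition bpair :: "baire \<Rightarrow> baire \<Rightarrow> baire" where
  "bpair p q = (\<lambda>n. if even n then p (n div 2) else q (n div 2))"
definition bleft :: "baire \<Rightarrow> baire" where "bleft x = (\<lambda>n. x (2 * n))"
definition bright :: "baire \<Rightarrow> baire" where "bright x = (\<lambda>n. x (2 * n + 1))"

definition bproj :: "nat \<Rightarrow> baire \<Rightarrow> baire" where
  "bproj i x = (\<lambda>n. x (prod_encode (i, n)))"

definition word_enc :: "bool list \<Rightarrow> nat" where
  "word_enc w = list_encode (map of_bool w)"

definition set_enc :: "nat set \<Rightarrow> nat" where
  "set_enc U = (\<Sum>c\<in>U. 2 ^ c)"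

definition prepend :: "bool list \<Rightarrow> cantor \<Rightarrow> cantor" where
  "prepend w p = (\<lambda>n. if n < length w then w ! n else p (n - length w))"

definition cylinders :: "bool list list \<Rightarrow> cantor set" where
  "cylinders ws = {p. \<exists>w\<in>set ws. \<forall>n<length w. p n = w ! n}"

record problem =
  pdom :: "baire set"
  psol :: "baire \<Rightarrow> baire \<Rightarrow> bool"

definition realizer :: "problem \<Rightarrow> (baire \<Rightarrow> baire) \<Rightarrow> bool" where
  "realizer P G \<longleftrightarrow> (\<forall>p\<in>pdom P. psol P p (G p))"

definition weihrauch_le :: "problem \<Rightarrow> problem \<Rightarrow> bool" (infix "\<le>\<^sub>W" 50) where
  "P \<le>\<^sub>W Q \<longleftrightarrow> (\<exists>eH eK. \<forall>G. realizer Q G \<longrightarrow>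
     (\<forall>p\<in>pdom P. \<exists>h. comp_fun eH p h \<and> h \<in> pdom Q \<and>
        (\<exists>k. comp_fun eK (bpair p (G h)) k \<and> psol P p k)))"

definition prob_prod :: "problem \<Rightarrow> problem \<Rightarrow> problem" (infixr "\<times>\<^sub>W" 70) where
  "P \<times>\<^sub>W Q = \<lparr> pdom = {x. bleft x \<in> pdom P \<and> bright x \<in> pdom Q},
      psol = (\<lambda>x r. psol P (bleft x) (bleft r) \<and> psol Q (bright x) (bright r)) \<rparr>"

definition parallel :: "problem \<Rightarrow> problem" where
  "parallel P = \<lparr> pdom = {x. \<forall>i. bproj i x \<in> pdom P},
      psol = (\<lambda>x r. \<forall>i. psol P (bproj i x) (bproj i r)) \<rparr>"

text \<open>Players are \<open>{0..<gplayers}\<close>, outcomes \<open>{0..<goutcomes}\<close>;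
  \<open>gpref G a c c1\<close> means \<open>c \<prec>\<^sub>a c1\<close> (player \<open>a\<close> strictly prefers \<open>c1\<close>).\<close>
record game =
  gplayers :: nat
  goutcomes :: nat
  gturn :: "bool list \<Rightarrow> nat"
  gpref :: "nat \<Rightarrow> nat \<Rightarrow> nat \<Rightarrow> bool"
  gval :: "cantor \<Rightarrow> nat"

type_synonym profile = "bool list \<Rightarrow> bool"

fun play_prefix :: "profile \<Rightarrow> bool list \<Rightarrow> nat \<Rightarrow> bool list" where
  "play_prefix s hs 0 = []"
| "play_prefix s hs (Suc n) = play_prefix s hs n @
     [if n < length hs then hs ! n else s (play_prefix s hs n)]"

definition play :: "profile \<Rightarrow> bool list \<Rightarrow> cantor" where
  "play s hs = (\<lambda>n. play_prefix s hs (Suc n) ! n)"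

definition wf_game :: "game \<Rightarrow> bool" where
  "wf_game G \<longleftrightarrow> (\<forall>h. gturn G h < gplayers G) \<and> (\<forall>p. gval G p < goutcomes G) \<and>
     (\<forall>a<gplayers G. wf {(c1, c). c < goutcomes G \<and> c1 < goutcomes G \<and> gpref G a c c1})"

definition nash_at :: "game \<Rightarrow> bool list \<Rightarrow> profile \<Rightarrow> bool" where
  "nash_at G hs s \<longleftrightarrow> (\<forall>a<gplayers G. \<forall>s'. (\<forall>h. gturn G h \<noteq> a \<longrightarrow> s' h = s h) \<longrightarrow>
      \<not> gpref G a (gval G (play s hs)) (gval G (play s' hs)))"

definition nash :: "game \<Rightarrow> profile \<Rightarrow> bool" where
  "nash G s \<longleftrightarrow> nash_at G [] s"

definition spe :: "game \<Rightarrow> profile \<Rightarrow> bool" where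
  "spe G s \<longleftrightarrow> (\<forall>hs. nash_at G hs s)"

text \<open>Win/lose game: players 0 and 1 (= players 1 and 2 of the paper), outcome 0 = \<open>w\<^sub>1\<close>,
  outcome 1 = \<open>w\<^sub>2\<close>, player \<open>i\<close> prefers outcome \<open>i\<close>; \<open>A\<close> is player 0's winning set.\<close>
definition wl_game :: "(bool list \<Rightarrow> nat) \<Rightarrow> cantor set \<Rightarrow> game" where
  "wl_game d A = \<lparr> gplayers = 2, goutcomes = 2, gturn = d,
     gpref = (\<lambda>a c c1. c1 = a \<and> c \<noteq> a \<and> c < 2),
     gval = (\<lambda>p. if p \<in> A then 0 else 1) \<rparr>"

definition has_winning_strategy :: "game \<Rightarrow> nat \<Rightarrow> bool" where
  "has_winning_strategy G a \<longleftrightarrow>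
     (\<exists>\<sigma>. \<forall>s. (\<forall>h. gturn G h = a \<longrightarrow> s h = \<sigma> h) \<longrightarrow> gval G (play s []) = a)"

definition upper_set :: "game \<Rightarrow> nat \<Rightarrow> nat set \<Rightarrow> bool" where
  "upper_set G a U \<longleftrightarrow> U \<subseteq> {..<goutcomes G} \<and>
     (\<forall>c\<in>U. \<forall>c1<goutcomes G. gpref G a c c1 \<longrightarrow> c1 \<in> U)"

text \<open>A represented pointclass is given by a representation: a set \<open>gdom\<close> of names and
  the map \<open>gnm\<close> sending a name to the subset of Cantor space it denotes;
  \<open>\<Gamma> = gnm ` gdom\<close>.\<close>

definition dec_profile :: "baire \<Rightarrow> profile" where
  "dec_profile q = (\<lambda>h. q (word_enc h) \<noteq> 0)"

definition game_name :: "baire set \<Rightarrow> (baire \<Rightarrow> cantor set) \<Rightarrow> baire \<Rightarrow> game \<Rightarrow> bool" where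
  "game_name gdom gnm x G \<longleftrightarrow>
     bproj 0 x 0 = gplayers G \<and> bproj 0 x 1 = goutcomes G \<and>
     (\<forall>h. bproj 1 x (word_enc h) = gturn G h) \<and>
     (\<forall>a<gplayers G. \<forall>c<goutcomes G. \<forall>c1<goutcomes G.
        (bproj 2 x (prod_encode (a, prod_encode (c, c1))) \<noteq> 0) = gpref G a c c1) \<and>
     (\<forall>a<gplayers G. \<forall>U. upper_set G a U \<longrightarrow>
        (let y = bproj (prod_encode (a, set_enc U)) (bproj 3 x) in
           y \<in> gdom \<and> gnm y = gval G -` U))"

definition antagonistic_linear :: "game \<Rightarrow> bool" where
  "antagonistic_linear G \<longleftrightarrow> gplayers G = 2 \<and>
     (\<forall>c<goutcomes G. \<not> gpref G 0 c c) \<and>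
     (\<forall>c<goutcomes G. \<forall>c1<goutcomes G. \<forall>c2<goutcomes G.
        gpref G 0 c c1 \<longrightarrow> gpref G 0 c1 c2 \<longrightarrow> gpref G 0 c c2) \<and>
     (\<forall>c<goutcomes G. \<forall>c1<goutcomes G. c \<noteq> c1 \<longrightarrow> gpref G 0 c c1 \<or> gpref G 0 c1 c) \<and>
     (\<forall>c<goutcomes G. \<forall>c1<goutcomes G. gpref G 1 c c1 \<longleftrightarrow> gpref G 0 c1 c)"

definition wl_dom :: "baire set \<Rightarrow> baire set" where
  "wl_dom gdom = {x. (\<forall>h. bleft x (word_enc h) < 2) \<and> bright x \<in> gdom}"

definition wl_of :: "(baire \<Rightarrow> cantor set) \<Rightarrow> baire \<Rightarrow> game" where
  "wl_of gnm x = wl_game (\<lambda>h. bleft x (word_enc h)) (gnm (bright x))"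

definition Det :: "baire set \<Rightarrow> (baire \<Rightarrow> cantor set) \<Rightarrow> problem" where
  "Det gdom gnm = \<lparr> pdom = wl_dom gdom,
     psol = (\<lambda>x q. nash (wl_of gnm x) (dec_profile q)) \<rparr>"

definition Win :: "baire set \<Rightarrow> (baire \<Rightarrow> cantor set) \<Rightarrow> problem" where
  "Win gdom gnm = \<lparr> pdom = wl_dom gdom,
     psol = (\<lambda>x q. q 0 < 2 \<and> has_winning_strategy (wl_of gnm x) (q 0)) \<rparr>"

definition SPE :: "baire set \<Rightarrow> (baire \<Rightarrow> cantor set) \<Rightarrow> problem" where
  "SPE gdom gnm = \<lparr> pdom = {x. \<exists>G. wf_game G \<and> antagonistic_linear G \<and> game_name gdom gnm x G},
     psol = (\<lambda>x q. \<forall>G. wf_game G \<longrightarrow> antagonistic_linear G \<longrightarrow> game_name gdom gnm x G \<longrightarrow>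
                      spe G (dec_profile q)) \<rparr>"

definition standing_assumptions :: "baire set \<Rightarrow> (baire \<Rightarrow> cantor set) \<Rightarrow> bool" where
  "standing_assumptions gdom gnm \<longleftrightarrow>
     (\<forall>x\<in>gdom. \<forall>d. (\<forall>h. d h < 2) \<longrightarrow>
        (\<exists>a<2. has_winning_strategy (wl_game d (gnm x)) a)) \<and>
     {} \<in> gnm ` gdom \<and> UNIV \<in> gnm ` gdom \<and>
     (\<exists>e. \<forall>w. \<forall>x\<in>gdom. \<exists>y. comp_fun e (bpair (\<lambda>_. word_enc w) x) y \<and> y \<in> gdom \<and>
        gnm y = prepend w ` gnm x) \<and>
     (\<exists>e. \<forall>w. \<forall>x\<in>gdom. \<exists>y. comp_fun e (bpair (\<lambda>_. word_enc w) x) y \<and> y \<in> gdom \<and>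
        gnm y = prepend w -` gnm x) \<and>
     (\<exists>e. \<forall>ws. \<forall>x\<in>gdom. \<exists>y.
        comp_fun e (bpair (\<lambda>_. list_encode (map word_enc ws)) x) y \<and> y \<in> gdom \<and>
        gnm y = gnm x \<inter> cylinders ws)"

end

theory Submission
  imports Defs
begin

text \<open>For a history \<open>t\<close> and an outcome \<open>c\<close>, Win and Det are asked about the subgame at \<open>t\<close> in which
  player 0 tries to reach an outcome that is at least as good as \<open>c\<close>, and about the one in which it
  has to be strictly better. The answers of Win determine the value of \<open>t\<close>, the best outcome that
  player 0 can guarantee; the corresponding answers of Det contain for each player a strategy that
  guarantees the value. In the equilibrium a player follows such a strategy for as long as the value
  stays the same and the player has not deviated from it, and otherwise switches to the one for
  the current history. If a player plays like this from \<open>t\<close> on, the value can only change in its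
  favour, hence finitely often, so from some point on a single strategy is followed and
  guarantees the value of \<open>t\<close>. As this holds for both players, nobody gains by deviating.\<close>

subsection \<open>Computable functions with an oracle\<close>

text \<open>One code has to serve every oracle in \<open>D\<close>, which makes the notion uniform.
  Restricting it to \<open>D\<close> admits unbounded searches that are known to terminate only for
  meaningful oracles.\<close>

definition computable :: "baire set \<Rightarrow> nat \<Rightarrow> (baire \<Rightarrow> nat list \<Rightarrow> nat) \<Rightarrow> bool" where
  "computable D k F \<longleftrightarrow> (\<exists>e. \<forall>p\<in>D. \<forall>xs. length xs = k \<longrightarrow> ev p e xs (F p xs))"

lemma computableI:
  assumes "\<And>p xs. p \<in> D \<Longrightarrow> length xs = k \<Longrightarrow> ev p e xs (F p xs)"
  shows "computable D k F"
  using assms unfolding computable_def by blast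

lemma computable_comp_fun:
  assumes "computable D 1 (\<lambda>p xs. F p (arg 0 xs))"
  shows "\<exists>e. \<forall>p\<in>D. comp_fun e p (F p)"
proof -
  obtain e where e: "\<And>p xs. p \<in> D \<Longrightarrow> length xs = 1 \<Longrightarrow> ev p e xs (F p (arg 0 xs))"
    using assms unfolding computable_def by blast
  have "comp_fun e p (F p)" if "p \<in> D" for p
    using e[OF that, of "[_]"] by (simp add: comp_fun_def arg_def)
  then show ?thesis by blast
qed

lemma computable_cong:
  assumes "computable D k F" and "\<And>p xs. p \<in> D \<Longrightarrow> length xs = k \<Longrightarrow> F p xs = G p xs"
  shows "computable D k G"
  using assms unfolding computable_def by metis

lemma arg_Cons [simp]: "arg 0 (x # xs) = x" "arg (Suc i) (x # xs) = arg i xs"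
  by (simp_all add: arg_def)

lemma arg_drop [simp]: "arg i (drop j xs) = arg (i + j) xs"
  by (auto simp: arg_def add.commute)

lemma computable_arg: "computable D k (\<lambda>p xs. arg i xs)"
  by (rule computableI) (rule ev_Pj)

lemma computable_arg_drop: "computable D k (\<lambda>p xs. arg i (drop j xs))"
  by (simp add: computable_arg)

lemma ev_Cn1: "ev p g xs y \<Longrightarrow> ev p f [y] v \<Longrightarrow> ev p (Cn f [g]) xs v"
  by (rule ev_Cn[where ys = "[y]"]) auto

lemma ev_Cn2: "ev p g xs y \<Longrightarrow> ev p g' xs y' \<Longrightarrow> ev p f [y, y'] v \<Longrightarrow> ev p (Cn f [g, g']) xs v"
  by (rule ev_Cn[where ys = "[y, y']"]) (auto simp: less_Suc_eq)

lemma ev_Cn3: "ev p g xs y \<Longrightarrow> ev p g' xs y' \<Longrightarrow> ev p g'' xs y'' \<Longrightarrow>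
    ev p f [y, y', y''] v \<Longrightarrow> ev p (Cn f [g, g', g'']) xs v"
  by (rule ev_Cn[where ys = "[y, y', y'']"]) (auto simp: less_Suc_eq)

lemma computable_comp1:
  assumes "computable D 1 (\<lambda>p xs. f p (arg 0 xs))" "computable D k A"
  shows "computable D k (\<lambda>p xs. f p (A p xs))"
proof -
  obtain e a where e: "\<And>p xs. p \<in> D \<Longrightarrow> length xs = 1 \<Longrightarrow> ev p e xs (f p (arg 0 xs))"
    and a: "\<And>p xs. p \<in> D \<Longrightarrow> length xs = k \<Longrightarrow> ev p a xs (A p xs)"
    using assms unfolding computable_def by blast
  show ?thesis
  proof (rule computableI)
    fix p :: baire and xs :: "nat list" assume *: "p \<in> D" "length xs = k"
    show "ev p (Cn e [a]) xs (f p (A p xs))"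
      using ev_Cn1[OF a[OF *]] e[OF *(1), of "[A p xs]"] by simp
  qed
qed

lemma computable_comp2:
  assumes "computable D 2 (\<lambda>p xs. f p (arg 0 xs) (arg 1 xs))" "computable D k A" "computable D k B"
  shows "computable D k (\<lambda>p xs. f p (A p xs) (B p xs))"
proof -
  obtain e a b where e: "\<And>p xs. p \<in> D \<Longrightarrow> length xs = 2 \<Longrightarrow> ev p e xs (f p (arg 0 xs) (arg 1 xs))"
    and a: "\<And>p xs. p \<in> D \<Longrightarrow> length xs = k \<Longrightarrow> ev p a xs (A p xs)"
    and b: "\<And>p xs. p \<in> D \<Longrightarrow> length xs = k \<Longrightarrow> ev p b xs (B p xs)"
    using assms unfolding computable_def by blast
  show ?thesis
  proof (rule computableI)
    fix p :: baire and xs :: "nat list" assume *: "p \<in> D" "length xs = k"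
    show "ev p (Cn e [a, b]) xs (f p (A p xs) (B p xs))"
      using ev_Cn2[OF a[OF *] b[OF *]] e[OF *(1), of "[A p xs, B p xs]"] by simp
  qed
qed

lemma computable_comp3:
  assumes "computable D 3 (\<lambda>p xs. f p (arg 0 xs) (arg 1 xs) (arg 2 xs))"
    "computable D k A" "computable D k B" "computable D k C"
  shows "computable D k (\<lambda>p xs. f p (A p xs) (B p xs) (C p xs))"
proof -
  obtain e a b c where
      e: "\<And>p xs. p \<in> D \<Longrightarrow> length xs = 3 \<Longrightarrow> ev p e xs (f p (arg 0 xs) (arg 1 xs) (arg 2 xs))"
    and a: "\<And>p xs. p \<in> D \<Longrightarrow> length xs = k \<Longrightarrow> ev p a xs (A p xs)"
    and b: "\<And>p xs. p \<in> D \<Longrightarrow> length xs = k \<Longrightarrow> ev p b xs (B p xs)"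
    and c: "\<And>p xs. p \<in> D \<Longrightarrow> length xs = k \<Longrightarrow> ev p c xs (C p xs)"
    using assms unfolding computable_def by blast
  show ?thesis
  proof (rule computableI)
    fix p :: baire and xs :: "nat list" assume *: "p \<in> D" "length xs = k"
    show "ev p (Cn e [a, b, c]) xs (f p (A p xs) (B p xs) (C p xs))"
      using ev_Cn3[OF a[OF *] b[OF *] c[OF *]] e[OF *(1), of "[A p xs, B p xs, C p xs]"]
      by (simp add: numeral_2_eq_2)
  qed
qed

section \<open>Closure under oracle access, recursion, search and arithmetic\<close>

lemma computable_oracle: "computable D k A \<Longrightarrow> computable D k (\<lambda>p xs. p (A p xs))"
  by (rule computable_comp1[where f = "\<lambda>p n. p n"]) (auto intro: computableI ev_Orc)

lemma computable_Suc: "computable D k A \<Longrightarrow> computable D k (\<lambda>p xs. Suc (A p xs))"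
  by (rule computable_comp1[where f = "\<lambda>p n. Suc n"]) (auto intro: computableI ev_Sc)

lemma computable_const: "computable D k (\<lambda>p xs. c)"
proof (induction c)
  case 0 then show ?case by (rule computableI) (rule ev_Zr)
next
  case (Suc c) then show ?case by (rule computable_Suc)
qed

lemma computable_rec:
  assumes "computable D k A"
    and "computable D (Suc (Suc k)) (\<lambda>p ys. B p (arg 0 ys) (arg 1 ys) (drop 2 ys))"
    and "computable D k N"
  shows "computable D k (\<lambda>p xs. rec_nat (A p xs) (\<lambda>n u. B p n u xs) (N p xs))"
proof -
  obtain a b c where a: "\<And>p xs. p \<in> D \<Longrightarrow> length xs = k \<Longrightarrow> ev p a xs (A p xs)"
    and b: "\<And>p xs. p \<in> D \<Longrightarrow> length xs = Suc (Suc k) \<Longrightarrow>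
              ev p b xs (B p (arg 0 xs) (arg 1 xs) (drop 2 xs))"
    and c: "\<And>p xs. p \<in> D \<Longrightarrow> length xs = k \<Longrightarrow> ev p c xs (N p xs)"
    using assms unfolding computable_def by blast
  show ?thesis
  proof (rule computableI)
    fix p :: baire and xs :: "nat list" assume *: "p \<in> D" "length xs = k"
    have rec: "ev p (Pr a b) (n # xs) (rec_nat (A p xs) (\<lambda>n u. B p n u xs) n)" for n
    proof (induction n)
      case 0 show ?case using a[OF *] by (auto intro: ev_Pr0)
    next
      case (Suc n)
      show ?case
        using ev_PrS[OF Suc] b[OF *(1), of "n # rec_nat (A p xs) (\<lambda>n u. B p n u xs) n # xs"] *(2)
        by (simp add: numeral_2_eq_2)
    qed
    \<comment> \<open>\<open>Pr\<close> recurses on its first argument, so the computed bound is put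
      in front and the projections copy the original arguments behind it.\<close>
    show "ev p (Cn (Pr a b) (c # map Pj [0..<k])) xs
        (rec_nat (A p xs) (\<lambda>n u. B p n u xs) (N p xs))"
    proof (rule ev_Cn[where ys = "N p xs # xs"])
      show "\<forall>i<length (c # map Pj [0..<k]). ev p ((c # map Pj [0..<k]) ! i) xs ((N p xs # xs) ! i)"
      proof safe
        fix i assume "i < length (c # map Pj [0..<k])"
        then show "ev p ((c # map Pj [0..<k]) ! i) xs ((N p xs # xs) ! i)"
          using c[OF *] ev_Pj[of p "i - 1" xs] *(2) by (cases i) (auto simp: arg_def)
      qed
    qed (use *(2) rec in auto)
  qed
qed

lemma computable_Least:
  assumes "computable D (Suc k) (\<lambda>p ys. of_bool (P p (arg 0 ys) (drop 1 ys)))"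
    and ex: "\<And>p xs. p \<in> D \<Longrightarrow> length xs = k \<Longrightarrow> \<exists>n. P p n xs"
  shows "computable D k (\<lambda>p xs. LEAST n. P p n xs)"
proof -
  \<comment> \<open>\<open>Mn\<close> looks for a zero, so the truth value has to be negated: this
    recursion sends 0 to 1 and 1 to 0.\<close>
  have "computable D (Suc k) (\<lambda>p ys. rec_nat 1 (\<lambda>n u. 0) (of_bool (P p (arg 0 ys) (drop 1 ys))))"
    by (rule computable_rec computable_const assms(1))+
  then obtain e where e: "\<And>p ys. p \<in> D \<Longrightarrow> length ys = Suc k \<Longrightarrow>
      ev p e ys (rec_nat 1 (\<lambda>n u. 0) (of_bool (P p (arg 0 ys) (drop 1 ys))))"
    unfolding computable_def by blast
  show ?thesis
  proof (rule computableI)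
    fix p :: baire and xs :: "nat list" assume *: "p \<in> D" "length xs = k"
    have e': "ev p e (n # xs) (if P p n xs then 0 else Suc 0)" for n
      using e[OF *(1), of "n # xs"] *(2) by (auto split: if_splits)
    show "ev p (Mn e) xs (LEAST n. P p n xs)"
    proof (rule ev_Mn)
      show "ev p e ((LEAST n. P p n xs) # xs) 0"
        using e'[of "LEAST n. P p n xs"] LeastI_ex[OF ex[OF *]] by simp
      show "\<forall>m<LEAST n. P p n xs. \<exists>u. ev p e (m # xs) (Suc u)"
        using e' not_less_Least by metis
    qed
  qed
qed

lemma computable_add:
  assumes "computable D k A" "computable D k B"
  shows "computable D k (\<lambda>p xs. A p xs + B p xs)"
proof -
  have "rec_nat a (\<lambda>n u. Suc u) b = a + b" for a b by (induction b) auto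
  then show ?thesis
    using computable_rec[OF assms(1), of "\<lambda>p n u xs. Suc u" B] assms(2)
    by (simp add: computable_Suc computable_arg)
qed

lemma computable_mult:
  assumes "computable D k A" "computable D k B"
  shows "computable D k (\<lambda>p xs. A p xs * B p xs)"
proof (rule computable_comp2[where f = "\<lambda>p a b. a * b"])
  have "rec_nat 0 (\<lambda>n u. u + a) b = a * b" for a b :: nat by (induction b) auto
  moreover have "computable D 2 (\<lambda>p xs. rec_nat 0 (\<lambda>n u. u + arg 0 xs) (arg 1 xs))"
    by (rule computable_rec computable_const computable_add computable_arg_drop computable_arg)+
  ultimately show "computable D 2 (\<lambda>p xs. arg 0 xs * arg 1 xs)" by simp
qed (rule assms)+

lemma computable_diff:
  assumes "computable D k A" "computable D k B"
  shows "computable D k (\<lambda>p xs. A p xs - B p xs)"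
proof (rule computable_comp2[where f = "\<lambda>p a b. a - b"])
  \<comment> \<open>A recursion that returns its last counter is the predecessor function; iterating
    it gives truncated subtraction.\<close>
  have pred: "rec_nat 0 (\<lambda>n u. n) b = b - 1" for b :: nat by (induction b) auto
  have "rec_nat a (\<lambda>n u. rec_nat 0 (\<lambda>n u. n) u) b = a - b" for a b :: nat
    by (induction b) (auto simp: pred)
  moreover have "computable D 2 (\<lambda>p xs. rec_nat (arg 0 xs) (\<lambda>n u. rec_nat 0 (\<lambda>n u. n) u) (arg 1 xs))"
    by (rule computable_rec computable_const computable_arg_drop computable_arg)+
  ultimately show "computable D 2 (\<lambda>p xs. arg 0 xs - arg 1 xs)" by simp
qed (rule assms)+

lemma computable_power2:
  assumes "computable D k A"
  shows "computable D k (\<lambda>p xs. 2 ^ A p xs)"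
proof (rule computable_comp1[where f = "\<lambda>p a. 2 ^ a"])
  have "rec_nat (1::nat) (\<lambda>n u. 2 * u) b = 2 ^ b" for b :: nat by (induction b) auto
  moreover have "computable D 1 (\<lambda>p xs. rec_nat 1 (\<lambda>n u. 2 * u) (arg 0 xs))"
    by (rule computable_rec computable_const computable_mult computable_arg_drop computable_arg)+
  ultimately show "computable D 1 (\<lambda>p xs. 2 ^ arg 0 xs)" by simp
qed (rule assms)

section \<open>Decidable predicates and case distinction\<close>

lemma computable_not:
  assumes "computable D k (\<lambda>p xs. of_bool (P p xs))"
  shows "computable D k (\<lambda>p xs. of_bool (\<not> P p xs))"
  by (rule computable_cong[OF computable_diff[OF computable_const[of D k 1] assms]]) auto

lemma computable_conj:
  assumes "computable D k (\<lambda>p xs. of_bool (P p xs))" "computable D k (\<lambda>p xs. of_bool (Q p xs))"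
  shows "computable D k (\<lambda>p xs. of_bool (P p xs \<and> Q p xs))"
  by (rule computable_cong[OF computable_mult[OF assms]]) auto

lemma computable_disj:
  assumes "computable D k (\<lambda>p xs. of_bool (P p xs))" "computable D k (\<lambda>p xs. of_bool (Q p xs))"
  shows "computable D k (\<lambda>p xs. of_bool (P p xs \<or> Q p xs))"
  by (rule computable_cong[OF computable_not[OF computable_conj[OF assms[THEN computable_not]]]]) auto

lemma computable_iff:
  assumes "computable D k (\<lambda>p xs. of_bool (P p xs))" "computable D k (\<lambda>p xs. of_bool (Q p xs))"
  shows "computable D k (\<lambda>p xs. of_bool (P p xs = Q p xs))"
  by (rule computable_cong[OF computable_disj[OF computable_conj[OF assms]
        computable_conj[OF assms[THEN computable_not]]]]) auto

lemma computable_neq0: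
  assumes "computable D k A"
  shows "computable D k (\<lambda>p xs. of_bool (A p xs \<noteq> 0))"
  by (rule computable_cong[OF computable_diff[OF computable_const[of D k 1]
          computable_diff[OF computable_const[of D k 1] assms]]]) auto

lemma computable_le:
  assumes "computable D k A" "computable D k B"
  shows "computable D k (\<lambda>p xs. of_bool (A p xs \<le> B p xs))"
  by (rule computable_cong[OF computable_not[OF computable_neq0[OF computable_diff[OF assms]]]]) auto

lemma computable_less:
  assumes "computable D k A" "computable D k B"
  shows "computable D k (\<lambda>p xs. of_bool (A p xs < B p xs))"
  by (rule computable_cong[OF computable_neq0[OF computable_diff[OF assms(2,1)]]]) auto

lemma computable_eq:
  assumes "computable D k A" "computable D k B"
  shows "computable D k (\<lambda>p xs. of_bool (A p xs = B p xs))"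
  by (rule computable_cong[OF computable_conj[OF computable_le[OF assms] computable_le[OF assms(2,1)]]])
     auto

lemma computable_if:
  assumes "computable D k (\<lambda>p xs. of_bool (P p xs))" "computable D k A" "computable D k B"
  shows "computable D k (\<lambda>p xs. if P p xs then A p xs else B p xs)"
  by (rule computable_cong[OF computable_add[OF computable_mult[OF assms(1,2)]
        computable_mult[OF computable_not[OF assms(1)] assms(3)]]]) auto

lemmas computable_basic_intros = computable_arg computable_arg_drop computable_const computable_Suc
  computable_oracle computable_add computable_mult computable_diff computable_power2
  computable_not computable_conj computable_disj computable_iff computable_le computable_less
  computable_eq computable_if computable_rec

section \<open>Halving and the inverse of the pairing function\<close>

lemma computable_div2:
  assumes "computable D k A"
  shows "computable D k (\<lambda>p xs. A p xs div 2)"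
proof (rule computable_comp1[where f = "\<lambda>p a. a div 2"])
  have "(LEAST q. a < 2 * q + 2) = a div 2" for a :: nat
    by (rule Least_equality) auto
  moreover have "computable D 1 (\<lambda>p xs. LEAST q. arg 0 xs < 2 * q + 2)"
  proof (rule computable_Least)
    fix xs show "\<exists>q. arg 0 xs < 2 * q + 2" by (rule exI[of _ "arg 0 xs"]) simp
  qed (rule computable_basic_intros)+
  ultimately show "computable D 1 (\<lambda>p xs. arg 0 xs div 2)" by simp
qed (rule assms)

lemma computable_even:
  assumes "computable D k A"
  shows "computable D k (\<lambda>p xs. of_bool (even (A p xs)))"
  by (rule computable_cong[OF computable_eq[OF assms
        computable_mult[OF computable_const[of D k 2] computable_div2[OF assms]]]])
     (auto dest: odd_pos)

lemma computable_triangle: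
  assumes "computable D k A"
  shows "computable D k (\<lambda>p xs. triangle (A p xs))"
  unfolding triangle_def by (rule computable_div2 computable_mult computable_Suc assms)+

lemma computable_prod_encode:
  assumes "computable D k A" "computable D k B"
  shows "computable D k (\<lambda>p xs. prod_encode (A p xs, B p xs))"
  unfolding prod_encode_def by (simp, intro computable_add computable_triangle assms)

text \<open>The number of the diagonal on which \<open>n\<close> lies in the Cantor enumeration of
  pairs, that is, the sum of the two components of the pair coded by \<open>n\<close>.\<close>

definition diag :: "nat \<Rightarrow> nat" where "diag n = (LEAST s. n < triangle (Suc s))"

lemma diag_prod_encode: "diag (prod_encode (a, b)) = a + b"
  unfolding diag_def
proof (rule Least_equality)
  show "prod_encode (a, b) < triangle (Suc (a + b))" by (simp add: prod_encode_def)
next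
  fix s assume *: "prod_encode (a, b) < triangle (Suc s)"
  have mono: "triangle i \<le> triangle j" if "i \<le> j" for i j
    using that by (induction rule: dec_induct) auto
  show "a + b \<le> s"
  proof (rule ccontr)
    assume "\<not> a + b \<le> s"
    then have "triangle (Suc s) \<le> triangle (a + b)" by (intro mono) simp
    with * show False by (simp add: prod_encode_def)
  qed
qed

lemma prod_encode_triangle_diag:
  "prod_encode z - triangle (diag (prod_encode z)) = fst z"
  "diag (prod_encode z) - fst z = snd z"
  by (cases z; simp add: diag_prod_encode; simp add: prod_encode_def)+

lemma computable_diag:
  assumes "computable D k A"
  shows "computable D k (\<lambda>p xs. diag (A p xs))"
proof (rule computable_comp1[where f = "\<lambda>p. diag"])
  show "computable D 1 (\<lambda>p xs. diag (arg 0 xs))"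
    unfolding diag_def
  proof (rule computable_Least)
    fix xs
    have "n < triangle (Suc n)" for n by (induction n) auto
    then show "\<exists>s. arg 0 xs < triangle (Suc s)" by blast
  qed (rule computable_triangle computable_basic_intros)+
qed (rule assms)

lemma computable_fst:
  assumes "computable D k A"
  shows "computable D k (\<lambda>p xs. fst (prod_decode (A p xs)))"
proof (rule computable_cong)
  show "computable D k (\<lambda>p xs. A p xs - triangle (diag (A p xs)))"
    by (rule computable_diff computable_triangle computable_diag assms)+
  have "n - triangle (diag n) = fst (prod_decode n)" for n
    using prod_encode_triangle_diag(1)[of "prod_decode n"] by simp
  then show "A p xs - triangle (diag (A p xs)) = fst (prod_decode (A p xs))" for p xs .
qed

lemma computable_snd:
  assumes "computable D k A"
  shows "computable D k (\<lambda>p xs. snd (prod_decode (A p xs)))"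
proof (rule computable_cong)
  show "computable D k (\<lambda>p xs. diag (A p xs) - fst (prod_decode (A p xs)))"
    by (rule computable_diff computable_fst computable_diag assms)+
  have "diag n - fst (prod_decode n) = snd (prod_decode n)" for n
    using prod_encode_triangle_diag(2)[of "prod_decode n"] by simp
  then show "diag (A p xs) - fst (prod_decode (A p xs)) = snd (prod_decode (A p xs))" for p xs .
qed

lemmas computable_intros = computable_div2 computable_even computable_prod_encode computable_fst
  computable_snd computable_basic_intros

section \<open>Running a program on an oracle that is itself computed\<close>

fun relativize :: "rf \<Rightarrow> nat \<Rightarrow> rf \<Rightarrow> rf" where
  "relativize g k Zr = Zr"
| "relativize g k Sc = Cn Sc [if 0 < k then Pj 0 else Zr]"
| "relativize g k (Pj i) = (if i < k then Pj i else Zr)"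
| "relativize g k Orc = Cn g [if 0 < k then Pj 0 else Zr, Pj k]"
| "relativize g k (Cn f gs) = Cn (relativize g (length gs) f) (map (relativize g k) gs @ [Pj k])"
| "relativize g k (Pr f h) = Pr (relativize g (k - 1) f) (relativize g (Suc k) h)"
| "relativize g k (Mn f) = Mn (relativize g (Suc k) f)"

lemma ev_arg0: "ev p (if 0 < length xs then Pj 0 else Zr) (xs @ [w]) (arg 0 xs)"
  using ev_Pj[of p 0 "xs @ [w]"] ev_Zr[of p "xs @ [w]"] by (auto simp: arg_def nth_append)

text \<open>The parameter \<open>w\<close> travels as an extra last argument; \<open>Pr\<close> and
  \<open>Mn\<close> add arguments only in front, so the tracked arity locates it at position
  \<open>k\<close>. Missing arguments read as 0, hence projections beyond the arity become
  \<open>Zr\<close>: otherwise they could pick up \<open>w\<close>. Each oracle call becomes a call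
  of \<open>g\<close> with this parameter.\<close>

lemma ev_relativize:
  assumes "ev q e xs v" and orc: "\<And>n. ev p g [n, w] (q n)"
  shows "ev p (relativize g (length xs) e) (xs @ [w]) v"
  using assms(1)
proof (induction rule: ev.induct)
  case (ev_Zr xs) show ?case by (simp add: ev.ev_Zr)
next
  case (ev_Sc xs)
  have "ev p Sc [arg 0 xs] (Suc (arg 0 xs))" using ev.ev_Sc[of p "[arg 0 xs]"] by simp
  then show ?case using ev_Cn1[OF ev_arg0] by simp
next
  case (ev_Pj i xs)
  show ?case using ev.ev_Pj[of p i "xs @ [w]"] ev.ev_Zr[of p "xs @ [w]"]
    by (auto simp: arg_def nth_append)
next
  case (ev_Orc xs)
  have "ev p (Pj (length xs)) (xs @ [w]) w"
    using ev.ev_Pj[of p "length xs" "xs @ [w]"] by (simp add: arg_def)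
  then show ?case using ev_Cn2[OF ev_arg0 _ orc] by simp
next
  case (ev_Cn ys gs xs f v)
  have last: "ev p (Pj (length xs)) (xs @ [w]) w"
    using ev.ev_Pj[of p "length xs" "xs @ [w]"] by (simp add: arg_def)
  show ?case unfolding relativize.simps
    by (rule ev.ev_Cn[where ys = "ys @ [w]"])
       (use ev_Cn last in \<open>auto simp: nth_append less_Suc_eq\<close>)
next
  case (ev_Pr0 f xs v h)
  then show ?case by (auto intro: ev.ev_Pr0)
next
  case (ev_PrS f h n xs u v)
  then show ?case by (auto intro: ev.ev_PrS)
next
  case (ev_Mn f n xs)
  then show ?case by (auto intro!: ev.ev_Mn)
qed

text \<open>The parameter \<open>w\<close> selects the oracle \<open>Q p w\<close> on which the given program is run.\<close>
lemma computable_relativize: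
  assumes Q: "computable D 2 (\<lambda>p xs. Q p (arg 1 xs) (arg 0 xs))"
    and e: "\<And>p w. p \<in> D \<Longrightarrow> comp_fun e (Q p w) (Y p w)"
    and "computable D k A" "computable D k B"
  shows "computable D k (\<lambda>p xs. Y p (A p xs) (B p xs))"
proof (rule computable_comp2[where f = Y])
  obtain g where g: "\<And>p xs. p \<in> D \<Longrightarrow> length xs = 2 \<Longrightarrow> ev p g xs (Q p (arg 1 xs) (arg 0 xs))"
    using Q unfolding computable_def by blast
  show "computable D 2 (\<lambda>p xs. Y p (arg 0 xs) (arg 1 xs))"
  proof (rule computableI)
    fix p :: baire and xs :: "nat list" assume *: "p \<in> D" "length xs = 2"
    then obtain w n where xs: "xs = [w, n]" by (auto simp: numeral_2_eq_2 length_Suc_conv)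
    have "ev p (relativize g 1 e) [n, w] (Y p w n)"
      using ev_relativize[of "Q p w" e "[n]" "Y p w n" p g w] g[OF *(1), of "[_, w]"] e[OF *(1)]
      by (simp add: comp_fun_def)
    then show "ev p (Cn (relativize g 1 e) [Pj 1, Pj 0]) xs (Y p (arg 0 xs) (arg 1 xs))"
      using ev_Cn2[OF ev_Pj[of p 1 xs] ev_Pj[of p 0 xs]] by (simp add: xs)
  qed
qed fact+

subsection \<open>Plays\<close>

abbreviation prefix_of :: "cantor \<Rightarrow> nat \<Rightarrow> bool list" where
  "prefix_of p n \<equiv> map p [0..<n]"

lemma prefix_of_play: "prefix_of (play s hs) n = play_prefix s hs n"
proof (induction n)
  case (Suc n)
  have "length (play_prefix s hs m) = m" for m by (induction m) auto
  then show ?case using Suc by (simp add: play_def nth_append)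
qed simp

lemma play_step: "play s hs k = (if k < length hs then hs ! k else s (prefix_of (play s hs) k))"
proof -
  have "length (play_prefix s hs m) = m" for m by (induction m) auto
  then show ?thesis unfolding prefix_of_play by (simp add: play_def nth_append)
qed

lemma prefix_of_eqD: "prefix_of p (length t) = t \<Longrightarrow> k < length t \<Longrightarrow> p k = t ! k"
  using nth_map_upt[of k "length t" 0 p] by simp

lemma play_extends: "prefix_of (play s hs) (length hs) = hs"
proof (rule nth_equalityI)
  fix i assume "i < length (prefix_of (play s hs) (length hs))"
  then have i: "i < length hs" by simp
  then have "play s hs i = hs ! i" by (subst play_step) simp
  with i show "prefix_of (play s hs) (length hs) ! i = hs ! i" by simp
qed simp

text \<open>Strong induction on the position: equal prefixes lead to equal moves.\<close>

lemma play_unique: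
  assumes "prefix_of p (length hs) = hs" "\<And>k. k \<ge> length hs \<Longrightarrow> p k = s (prefix_of p k)"
  shows "p = play s hs"
proof
  fix k show "p k = play s hs k"
  proof (induction k rule: less_induct)
    case (less k)
    then have *: "prefix_of (play s hs) k = prefix_of p k" by auto
    show ?case
      using assms(2)[of k] prefix_of_eqD[OF assms(1), of k]
      by (subst play_step) (simp only: *, simp)
  qed
qed

subsection \<open>Win/lose games\<close>

text \<open>Quantifying over the sequences consistent with \<open>\<sigma>\<close> removes the
  opponent's strategy. As \<open>A\<close> belongs to player 0, the final equivalence says that
  player \<open>a\<close> wins, for \<open>a < 2\<close>.\<close>

definition wins :: "(bool list \<Rightarrow> nat) \<Rightarrow> cantor set \<Rightarrow> nat \<Rightarrow> profile \<Rightarrow> bool" where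
  "wins d A a \<sigma> \<longleftrightarrow>
     (\<forall>q. (\<forall>k. d (prefix_of q k) = a \<longrightarrow> q k = \<sigma> (prefix_of q k)) \<longrightarrow> (q \<in> A \<longleftrightarrow> a = 0))"

lemma wins_play:
  assumes "wins d A a \<sigma>" "\<And>h. d h = a \<Longrightarrow> s h = \<sigma> h"
  shows "play s [] \<in> A \<longleftrightarrow> a = 0"
proof -
  have "play s [] k = \<sigma> (prefix_of (play s []) k)" if "d (prefix_of (play s []) k) = a" for k
    using assms(2)[OF that] by (subst play_step) simp
  then show ?thesis using assms(1) unfolding wins_def by blast
qed

lemma winsI_plays:
  assumes "a < 2" and "\<And>s. (\<And>h. d h = a \<Longrightarrow> s h = \<sigma> h) \<Longrightarrow> gval (wl_game d A) (play s []) = a"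
  shows "wins d A a \<sigma>"
  unfolding wins_def
proof (intro allI impI)
  fix q assume q: "\<forall>k. d (prefix_of q k) = a \<longrightarrow> q k = \<sigma> (prefix_of q k)"
  \<comment> \<open>The opponent replays \<open>q\<close>, looking only at the length of the
    history.\<close>
  define s where "s = (\<lambda>h. if d h = a then \<sigma> h else q (length h))"
  have "q = play s []" by (rule play_unique) (use q in \<open>auto simp: s_def\<close>)
  moreover have "gval (wl_game d A) (play s []) = a" by (rule assms) (simp add: s_def)
  ultimately show "q \<in> A \<longleftrightarrow> a = 0" using \<open>a < 2\<close> by (auto simp: wl_game_def split: if_splits)
qed

lemma wins_iff_has_winning_strategy:
  assumes "a < 2"
  shows "(\<exists>\<sigma>. wins d A a \<sigma>) \<longleftrightarrow> has_winning_strategy (wl_game d A) a"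
proof
  assume "\<exists>\<sigma>. wins d A a \<sigma>"
  then obtain \<sigma> where \<sigma>: "wins d A a \<sigma>" by blast
  have "gval (wl_game d A) (play s []) = a" if "\<forall>h. d h = a \<longrightarrow> s h = \<sigma> h" for s
    using wins_play[OF \<sigma>, of s] that assms by (auto simp: wl_game_def)
  then show "has_winning_strategy (wl_game d A) a"
    unfolding has_winning_strategy_def by (intro exI[of _ \<sigma>]) (simp add: wl_game_def)
next
  assume "has_winning_strategy (wl_game d A) a"
  then obtain \<sigma> where "\<And>s. (\<And>h. d h = a \<Longrightarrow> s h = \<sigma> h) \<Longrightarrow> gval (wl_game d A) (play s []) = a"
    unfolding has_winning_strategy_def by (auto simp: wl_game_def)
  then show "\<exists>\<sigma>. wins d A a \<sigma>" using winsI_plays[OF assms] by blast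
qed

text \<open>Two winning strategies could be played against each other.\<close>

lemma not_both_win: "\<not> (wins d A 0 \<sigma> \<and> wins d A 1 \<tau>)"
proof
  assume *: "wins d A 0 \<sigma> \<and> wins d A 1 \<tau>"
  define s where "s = (\<lambda>h. if d h = 0 then \<sigma> h else \<tau> h)"
  have "play s [] \<in> A" "play s [] \<notin> A"
    using wins_play[of d A 0 \<sigma> s] wins_play[of d A 1 \<tau> s] * by (simp_all add: s_def)
  then show False by blast
qed

lemma has_winning_strategy_unique:
  assumes "has_winning_strategy (wl_game d A) a" "has_winning_strategy (wl_game d A) b" "a < 2" "b < 2"
  shows "a = b"
  using assms not_both_win[of d A]
  by (auto simp flip: wins_iff_has_winning_strategy simp: less_2_cases_iff)

lemma not_wins_empty: "\<not> has_winning_strategy (wl_game d {}) 0"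
  using wins_play[of d "{}" 0] by (auto simp flip: wins_iff_has_winning_strategy)

lemma not_wins_UNIV: "\<not> has_winning_strategy (wl_game d UNIV) 1"
  using wins_play[of d "UNIV" 1] by (auto simp flip: wins_iff_has_winning_strategy)

text \<open>In an equilibrium the player who can win does win, since changing to a winning strategy
  must not be a gain. Then no deviation of the opponent may alter the result, so the winner's part
  of the equilibrium beats every opponent.\<close>

lemma nash_wins:
  assumes d: "\<And>h. d h < 2" and nash: "nash (wl_game d A) s"
    and win: "has_winning_strategy (wl_game d A) a" and a: "a < 2"
  shows "wins d A a s"
proof (rule winsI_plays[OF a])
  let ?G = "wl_game d A"
  have stable: "\<not> (gval ?G (play s' []) = b \<and> gval ?G (play s []) \<noteq> b)"
    if "b < 2" "\<And>h. d h \<noteq> b \<Longrightarrow> s' h = s h" for b s'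
    using nash[unfolded nash_def nash_at_def, rule_format, of b s'] that by (auto simp: wl_game_def)
  have val: "gval ?G p < 2" for p by (simp add: wl_game_def)
  obtain \<sigma> where \<sigma>: "\<And>s. (\<And>h. d h = a \<Longrightarrow> s h = \<sigma> h) \<Longrightarrow> gval ?G (play s []) = a"
    using win unfolding has_winning_strategy_def by (auto simp: wl_game_def)
  have s: "gval ?G (play s []) = a"
    using stable[of a "\<lambda>h. if d h = a then \<sigma> h else s h"] \<sigma> a by auto
  fix s' assume s': "\<And>h. d h = a \<Longrightarrow> s' h = s h"
  have "d h = a" if "d h \<noteq> 1 - a" for h using d[of h] a that by auto
  then have "gval ?G (play s' []) \<noteq> 1 - a"
    using stable[of "1 - a" s'] s' s a by (auto simp: less_2_cases_iff)
  then show "gval ?G (play s' []) = a" using val[of "play s' []"] a by auto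
qed

subsection \<open>Antagonistic games\<close>

locale antagonistic_game =
  fixes G :: game
  assumes wf: "wf_game G" and antagonistic: "antagonistic_linear G"
begin

abbreviation "N \<equiv> goutcomes G"
abbreviation "d \<equiv> gturn G"
abbreviation "v \<equiv> gval G"

section \<open>The linear preference orders of the two players\<close>

definition weakly_prefers :: "nat \<Rightarrow> nat \<Rightarrow> nat \<Rightarrow> bool" where
  "weakly_prefers a c c1 \<longleftrightarrow> c1 = c \<or> gpref G a c c1"

lemma players: "gplayers G = 2"
  using antagonistic by (simp add: antagonistic_linear_def)

lemma v_less: "v p < N"
  using wf by (simp add: wf_game_def)

lemma d_less: "d h < 2"
  using wf players by (simp add: wf_game_def)

lemma pref_1: "c < N \<Longrightarrow> c1 < N \<Longrightarrow> gpref G 1 c c1 \<longleftrightarrow> gpref G 0 c1 c"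
  using antagonistic unfolding antagonistic_linear_def by blast

lemma pref_0_total: "c < N \<Longrightarrow> c1 < N \<Longrightarrow> c \<noteq> c1 \<Longrightarrow> gpref G 0 c c1 \<or> gpref G 0 c1 c"
  using antagonistic unfolding antagonistic_linear_def by blast

lemma pref_0_irrefl: "c < N \<Longrightarrow> \<not> gpref G 0 c c"
  using antagonistic unfolding antagonistic_linear_def by blast

lemma pref_0_trans: "gpref G 0 c c1 \<Longrightarrow> gpref G 0 c1 c2 \<Longrightarrow> c < N \<Longrightarrow> c1 < N \<Longrightarrow> c2 < N \<Longrightarrow>
    gpref G 0 c c2"
  using antagonistic unfolding antagonistic_linear_def by blast

lemma pref_opponent: "a < 2 \<Longrightarrow> c < N \<Longrightarrow> c1 < N \<Longrightarrow> gpref G (1 - a) c c1 \<longleftrightarrow> gpref G a c1 c"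
  using pref_1 by (auto simp: less_2_cases_iff)

lemma pref_irrefl: "a < 2 \<Longrightarrow> c < N \<Longrightarrow> \<not> gpref G a c c"
  using pref_0_irrefl pref_1 by (auto simp: less_2_cases_iff)

lemma pref_trans: "a < 2 \<Longrightarrow> gpref G a c c1 \<Longrightarrow> gpref G a c1 c2 \<Longrightarrow> c < N \<Longrightarrow> c1 < N \<Longrightarrow> c2 < N \<Longrightarrow>
    gpref G a c c2"
  using pref_0_trans[of c c1 c2] pref_0_trans[of c2 c1 c] pref_1[of c c1] pref_1[of c1 c2] pref_1[of c c2]
  by (auto simp: less_2_cases_iff)

lemma weakly_prefers_trans:
  "a < 2 \<Longrightarrow> weakly_prefers a c c1 \<Longrightarrow> weakly_prefers a c1 c2 \<Longrightarrow> c < N \<Longrightarrow> c1 < N \<Longrightarrow> c2 < N \<Longrightarrow>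
    weakly_prefers a c c2"
  using pref_trans unfolding weakly_prefers_def by blast

lemma pref_asym: "a < 2 \<Longrightarrow> c < N \<Longrightarrow> c1 < N \<Longrightarrow> gpref G a c c1 \<Longrightarrow> \<not> gpref G a c1 c"
  using pref_trans pref_irrefl by blast

lemma weakly_prefers_opponent:
  "a < 2 \<Longrightarrow> c < N \<Longrightarrow> c1 < N \<Longrightarrow> weakly_prefers (1 - a) c c1 \<longleftrightarrow> weakly_prefers a c1 c"
  using pref_opponent by (auto simp: weakly_prefers_def)

lemma weakly_prefers_antisym:
  "a < 2 \<Longrightarrow> c < N \<Longrightarrow> c1 < N \<Longrightarrow> weakly_prefers a c c1 \<Longrightarrow> weakly_prefers a c1 c \<Longrightarrow> c = c1"
  using pref_asym unfolding weakly_prefers_def by blast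

section \<open>Threshold games and the value of a history\<close>

lemma most_preferred:
  assumes "a < 2" "S \<subseteq> {..<N}" "c \<in> S"
  shows "\<exists>z\<in>S. \<forall>y\<in>S. \<not> gpref G a z y"
proof -
  let ?R = "{(c1, c). c < N \<and> c1 < N \<and> gpref G a c c1}"
  have "wf ?R"
    using wf players assms(1) by (simp add: wf_game_def)
  then show ?thesis
  proof (rule wfE_min[OF _ assms(3)])
    fix z assume z: "z \<in> S" and min: "\<And>y. (y, z) \<in> ?R \<Longrightarrow> y \<notin> S"
    have "\<not> gpref G a z y" if "y \<in> S" for y using min[of y] z that assms(2) by auto
    with z show ?thesis by blast
  qed
qed

text \<open>The set of outcomes that player 0 aims for: those at least as good as \<open>c\<close>
  if \<open>a = 0\<close>, and those strictly better otherwise. The flag doubles as the player for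
  whom a win is informative. Indices \<open>c\<close> that are no outcomes give the empty
  set.\<close>

definition upper :: "nat \<Rightarrow> nat \<Rightarrow> nat set" where
  "upper c a = {z. z < N \<and> c < N \<and> (a = 0 \<and> z = c \<or> gpref G 0 c z)}"

lemma upper_set_upper: "upper_set G 0 (upper c a)"
  unfolding upper_set_def upper_def using pref_0_trans[of c] by blast

text \<open>For \<open>a = 1\<close>, missing the strictly better outcomes means, by linearity and
  antagonism, that player 1 gets at least \<open>c\<close> in its own order.\<close>

lemma upper_0_or_1:
  assumes "a < 2" "c < N" "z < N"
  shows "(z \<in> upper c a \<longleftrightarrow> a = 0) \<longleftrightarrow> weakly_prefers a c z"
  using assms pref_0_total[of c z] pref_0_irrefl pref_asym[of 0 c z]
  by (auto simp: less_2_cases_iff upper_def weakly_prefers_def pref_1[unfolded One_nat_def])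

definition subgame_set :: "bool list \<Rightarrow> nat \<Rightarrow> nat \<Rightarrow> cantor set" where
  "subgame_set t c a = prepend t -` (v -` upper c a)"

abbreviation subgame :: "bool list \<Rightarrow> nat \<Rightarrow> nat \<Rightarrow> game" where
  "subgame t c a \<equiv> wl_game (\<lambda>w. d (t @ w)) (subgame_set t c a)"

text \<open>The value is the outcome best for player 0 among those that player 0 can guarantee; hence
  player 1 wins the game for the strictly better outcomes.\<close>
lemma value_exists:
  assumes W: "\<And>c a. W c a < 2" "\<And>c a. has_winning_strategy (subgame t c a) (W c a)"
  shows "\<exists>c. W c 0 = 0 \<and> W c 1 = 1"
proof -
  \<comment> \<open>The outcome best for player 1 is worst for player 0, which therefore wins the
    game for at least \<open>b\<close> trivially; the argument \<open>undefined\<close> of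
    \<open>v\<close> merely shows that there is an outcome.\<close>
  obtain b where b: "b < N" "\<And>y. y < N \<Longrightarrow> \<not> gpref G 1 b y"
    using most_preferred[of 1 "{..<N}" "v undefined"] v_less by auto
  have "upper b 0 = {..<N}"
    using b pref_0_total[of b] pref_1[of b] by (auto simp: upper_def)
  then have "subgame_set t b 0 = UNIV" using v_less by (auto simp: subgame_set_def)
  then have "W b 0 \<noteq> 1" using W(2)[of b 0] not_wins_UNIV by auto
  with W(1)[of b 0] have "W b 0 = 0" by simp
  \<comment> \<open>Among the outcomes that player 0 can guarantee, the best one for it is the
    value.\<close>
  with b(1) obtain c where c: "c < N" "W c 0 = 0"
    and max: "\<And>y. y < N \<Longrightarrow> W y 0 = 0 \<Longrightarrow> \<not> gpref G 0 c y"
    using most_preferred[of 0 "{c. c < N \<and> W c 0 = 0}" b] by auto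
  have "W c 1 \<noteq> 0"
  proof
    assume "W c 1 = 0"
    have "upper c 1 \<noteq> {}"
    proof
      assume "upper c 1 = {}"
      then have "subgame_set t c 1 = {}" by (simp add: subgame_set_def)
      then show False using W(2)[of c 1] \<open>W c 1 = 0\<close> not_wins_empty by simp
    qed
    \<comment> \<open>The next outcome above \<open>c\<close> in the order of player 0: reaching at
      least \<open>z\<close> is the same as exceeding \<open>c\<close>, so a win for
      \<open>c\<close> with flag 1 contradicts the maximality of \<open>c\<close>.\<close>
    then obtain z where z: "z \<in> upper c 1"
      and min: "\<And>y. y \<in> upper c 1 \<Longrightarrow> \<not> gpref G 1 z y"
      using most_preferred[of 1 "upper c 1"] by (fastforce simp: upper_def)
    have "upper z 0 = upper c 1"
    proof (intro set_eqI iffI)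
      fix x assume "x \<in> upper z 0"
      then show "x \<in> upper c 1" using z pref_0_trans[of c z x] by (auto simp: upper_def)
    next
      fix x assume x: "x \<in> upper c 1"
      show "x \<in> upper z 0"
        using x min[OF x] z pref_0_total[of z x] pref_1[of z x] by (auto simp: upper_def)
    qed
    then have "subgame_set t z 0 = subgame_set t c 1" by (simp add: subgame_set_def)
    then have "W z 0 = W c 1"
      using has_winning_strategy_unique[OF W(2)[of z 0]] W(2)[of c 1] W(1) by simp
    then show False using max[of z] z \<open>W c 1 = 0\<close> by (simp add: upper_def)
  qed
  with W(1)[of c 1] c show ?thesis by (intro exI[of _ c]) auto
qed

text \<open>Outside the range of outcomes the winning set is empty, so a search over all numbers can
  only return an outcome.\<close>

lemma value_less:
  assumes "has_winning_strategy (subgame t c 0) 0"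
  shows "c < N"
proof (rule ccontr)
  assume "\<not> c < N"
  then have "subgame_set t c 0 = {}" by (auto simp: subgame_set_def upper_def)
  then show False using assms not_wins_empty by simp
qed

lemma wins_subgame:
  assumes "wins (\<lambda>w. d (t @ w)) (subgame_set t c a) a \<sigma>" and "a < 2" "c < N"
    and p: "prefix_of p (length t) = t"
    and f: "\<And>k. k \<ge> length t \<Longrightarrow> d (prefix_of p k) = a \<Longrightarrow> p k = \<sigma> (map p [length t..<k])"
  shows "weakly_prefers a c (v p)"
proof -
  \<comment> \<open>The tail of \<open>p\<close> after \<open>t\<close> is the corresponding run of
    the subgame.\<close>
  define q where "q = (\<lambda>n. p (n + length t))"
  have pq: "prepend t q = p"
    using prefix_of_eqD[OF p] by (auto simp: prepend_def q_def)
  have q: "prefix_of q k = map p [length t..<k + length t]" for k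
    by (rule nth_equalityI) (auto simp: q_def add.commute)
  have tq: "t @ prefix_of q k = prefix_of p (k + length t)" for k
  proof -
    have "prefix_of p (k + length t) = prefix_of p (length t) @ map p [length t..<k + length t]"
      using upt_add_eq_append[of 0 "length t" k] by (simp add: add.commute)
    then show ?thesis by (simp add: p q)
  qed
  have "q \<in> subgame_set t c a \<longleftrightarrow> a = 0"
  proof (rule assms(1)[unfolded wins_def, rule_format])
    fix k assume "d (t @ prefix_of q k) = a"
    then have "p (k + length t) = \<sigma> (map p [length t..<k + length t])"
      unfolding tq by (intro f) simp
    then show "q k = \<sigma> (prefix_of q k)" unfolding q by (simp only: q_def)
  qed
  then have "v p \<in> upper c a \<longleftrightarrow> a = 0" by (simp add: subgame_set_def pq)
  then show ?thesis using upper_0_or_1[OF assms(2,3) v_less] by simp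
qed

end

text \<open>Histories are processed in reverse here. The age is the number of moves since player \<open>a\<close>
  last switched to a fresh strategy, which happens when the value has changed or the player has
  deviated from the strategy \<open>\<sigma>\<close> followed so far.\<close>
fun age :: "(bool list \<Rightarrow> nat) \<Rightarrow> (bool list \<Rightarrow> nat) \<Rightarrow> (nat \<Rightarrow> bool list \<Rightarrow> bool list \<Rightarrow> bool) \<Rightarrow>
    nat \<Rightarrow> bool list \<Rightarrow> nat" where
  "age d V \<sigma> a [] = 0"
| "age d V \<sigma> a (b # g) =
     (let u = age d V \<sigma> a g in
      if V (b # g) = V g \<and> (d g \<noteq> a \<or> b = \<sigma> a (drop u g) (rev (take u g)))
      then Suc u else 0)"

text \<open>This isolates what the equilibrium argument needs from the answers of Win and Det: a
  value for every history and, for each player, a strategy securing it that sees only the moves made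
  since \<open>t\<close>.\<close>

locale solved_game = antagonistic_game +
  fixes V :: "bool list \<Rightarrow> nat" and \<sigma> :: "nat \<Rightarrow> bool list \<Rightarrow> bool list \<Rightarrow> bool"
  assumes V_less: "V t < N"
    and \<sigma>: "\<And>a t p. a < 2 \<Longrightarrow> prefix_of p (length t) = t \<Longrightarrow>
      (\<And>k. k \<ge> length t \<Longrightarrow> d (prefix_of p k) = a \<Longrightarrow> p k = \<sigma> a t (map p [length t..<k])) \<Longrightarrow>
      weakly_prefers a (V t) (v p)"
begin

section \<open>The equilibrium profile and the outcomes a player can force\<close>

definition solution_age :: "nat \<Rightarrow> bool list \<Rightarrow> nat" where
  "solution_age a = age (\<lambda>g. d (rev g)) (\<lambda>g. V (rev g)) (\<lambda>a g. \<sigma> a (rev g)) a"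

definition solution :: profile where
  "solution h = (let g = rev h; u = solution_age (d h) g
     in \<sigma> (d h) (rev (drop u g)) (rev (take u g)))"

definition can_force :: "nat \<Rightarrow> nat \<Rightarrow> bool list \<Rightarrow> bool" where
  "can_force a c t \<longleftrightarrow> (\<exists>\<tau>. \<forall>p. prefix_of p (length t) = t \<longrightarrow>
     (\<forall>k\<ge>length t. d (prefix_of p k) = a \<longrightarrow> p k = \<tau> (prefix_of p k)) \<longrightarrow> weakly_prefers a c (v p))"

lemma can_force_V: "a < 2 \<Longrightarrow> can_force a (V t) t"
  unfolding can_force_def
proof (intro exI[of _ "\<lambda>h. \<sigma> a t (drop (length t) h)"] allI impI)
  fix p assume "a < 2" "prefix_of p (length t) = t"
    "\<forall>k\<ge>length t. d (prefix_of p k) = a \<longrightarrow> p k = \<sigma> a t (drop (length t) (prefix_of p k))"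
  then show "weakly_prefers a (V t) (v p)" by (intro \<sigma>) (auto simp: drop_map)
qed

text \<open>Let the strategy forcing \<open>c\<close> play against the opponent's strategy for the
  value. The resulting outcome is at least \<open>c\<close> and at most \<open>V t\<close> in the
  order of player \<open>a\<close>.\<close>

lemma can_force_le:
  assumes "a < 2" "c < N" "can_force a c t"
  shows "weakly_prefers a c (V t)"
proof -
  obtain \<tau> where \<tau>: "\<And>p. prefix_of p (length t) = t \<Longrightarrow>
     (\<And>k. k\<ge>length t \<Longrightarrow> d (prefix_of p k) = a \<Longrightarrow> p k = \<tau> (prefix_of p k)) \<Longrightarrow> weakly_prefers a c (v p)"
    using assms(3) unfolding can_force_def by blast
  have "1 - a < 2" by simp
  from can_force_V[OF this, of t] obtain \<rho> where \<rho>: "\<And>p. prefix_of p (length t) = t \<Longrightarrow>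
     (\<And>k. k\<ge>length t \<Longrightarrow> d (prefix_of p k) = 1 - a \<Longrightarrow> p k = \<rho> (prefix_of p k)) \<Longrightarrow>
     weakly_prefers (1 - a) (V t) (v p)"
    unfolding can_force_def by blast
  define p where "p = play (\<lambda>h. if d h = a then \<tau> h else \<rho> h) t"
  have step: "p k = (if d (prefix_of p k) = a then \<tau> (prefix_of p k) else \<rho> (prefix_of p k))"
    if "k \<ge> length t" for k
    using that play_step[of _ t k] by (simp add: p_def)
  have ext: "prefix_of p (length t) = t" by (simp add: p_def play_extends)
  have "weakly_prefers a c (v p)" by (rule \<tau>) (use ext step in auto)
  moreover have "weakly_prefers (1 - a) (V t) (v p)"
    by (rule \<rho>) (use ext step assms(1) in \<open>auto simp: less_2_cases_iff\<close>)
  ultimately show ?thesis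
    using weakly_prefers_opponent weakly_prefers_trans assms v_less V_less by blast
qed

section \<open>Following the profile along a fixed sequence of moves\<close>

context
  fixes a :: nat and p :: cantor
  assumes a: "a < 2"
begin

text \<open>The position at which player \<open>a\<close> adopted the strategy that is in use after
  \<open>n\<close> moves of \<open>p\<close>.\<close>

private abbreviation "anchor n \<equiv> n - solution_age a (rev (prefix_of p n))"

private lemma rev_drop_prefix: "rev (drop u (rev (prefix_of p n))) = prefix_of p (n - u)"
  by (simp add: rev_drop take_map)

private lemma rev_take_prefix: "rev (take u (rev (prefix_of p n))) = map p [n - u..<n]"
  by (simp add: rev_take drop_map)

private lemma solution_age_Suc: "solution_age a (rev (prefix_of p (Suc n))) =
    (if V (prefix_of p (Suc n)) = V (prefix_of p n) \<and>
        (d (prefix_of p n) \<noteq> a \<or> p n = \<sigma> a (prefix_of p (anchor n)) (map p [anchor n..<n]))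
     then Suc (solution_age a (rev (prefix_of p n))) else 0)"
  using rev_drop_prefix rev_take_prefix by (simp add: solution_age_def Let_def)

text \<open>A positive age records that no move since the anchor changed the value or departed from
  the strategy adopted there. After a reset the anchor is the current position and the last clause
  is vacuous.\<close>

private lemma anchor_invariant:
  "solution_age a (rev (prefix_of p n)) \<le> n \<and> V (prefix_of p (anchor n)) = V (prefix_of p n) \<and>
   (\<forall>k. anchor n \<le> k \<and> k < n \<and> d (prefix_of p k) = a \<longrightarrow>
      p k = \<sigma> a (prefix_of p (anchor n)) (map p [anchor n..<k]))"
proof (induction n)
  case 0 show ?case by (simp add: solution_age_def)
next
  case (Suc n)
  show ?case
  proof (cases "solution_age a (rev (prefix_of p (Suc n))) = 0")
    case True
    then show ?thesis by (auto simp del: upt_Suc)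
  next
    case False
    then have c: "V (prefix_of p (Suc n)) = V (prefix_of p n)"
      "d (prefix_of p n) = a \<Longrightarrow> p n = \<sigma> a (prefix_of p (anchor n)) (map p [anchor n..<n])"
      "solution_age a (rev (prefix_of p (Suc n))) = Suc (solution_age a (rev (prefix_of p n)))"
      unfolding solution_age_Suc by (auto split: if_splits)
    have m: "anchor (Suc n) = anchor n" by (simp only: c(3) diff_Suc_Suc)
    show ?thesis unfolding m c(1)
    proof (intro conjI allI impI)
      show "solution_age a (rev (prefix_of p (Suc n))) \<le> Suc n" using Suc unfolding c(3) by simp
      show "V (prefix_of p (anchor n)) = V (prefix_of p n)" using Suc by blast
    next
      fix k assume k: "anchor n \<le> k \<and> k < Suc n \<and> d (prefix_of p k) = a"
      show "p k = \<sigma> a (prefix_of p (anchor n)) (map p [anchor n..<k])"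
      proof (cases "k = n")
        case True
        then show ?thesis using c(2) k by blast
      next
        case False
        then have "k < n" using k by simp
        then show ?thesis using Suc k by blast
      qed
    qed
  qed
qed

context
  fixes m :: nat
  assumes follows: "\<And>k. k \<ge> m \<Longrightarrow> d (prefix_of p k) = a \<Longrightarrow> p k = solution (prefix_of p k)"
begin

private lemma follows_anchor:
  assumes "k \<ge> m" "d (prefix_of p k) = a"
  shows "p k = \<sigma> a (prefix_of p (anchor k)) (map p [anchor k..<k])"
  using follows[OF assms] assms(2) by (simp add: solution_def Let_def rev_drop_prefix rev_take_prefix)

text \<open>The strategy adopted at the anchor is still respected after move \<open>n\<close>,
  whoever makes it, so continuing with it forces the anchor's value, which equals the value at
  \<open>n\<close>. By \<open>can_force_le\<close> the next value is at least as good for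
  \<open>a\<close>.\<close>

private lemma V_step:
  assumes "n \<ge> m"
  shows "weakly_prefers a (V (prefix_of p n)) (V (prefix_of p (Suc n)))"
proof (rule can_force_le[OF a V_less], unfold can_force_def,
    intro exI[of _ "\<lambda>h. \<sigma> a (prefix_of p (anchor n)) (drop (anchor n) h)"] allI impI)
  fix q
  assume q: "prefix_of q (length (prefix_of p (Suc n))) = prefix_of p (Suc n)"
    and f: "\<forall>k\<ge>length (prefix_of p (Suc n)). d (prefix_of q k) = a \<longrightarrow>
      q k = \<sigma> a (prefix_of p (anchor n)) (drop (anchor n) (prefix_of q k))"
  have qp: "q k = p k" if "k < Suc n" for k
    using prefix_of_eqD[OF q, of k] that by (simp del: upt_Suc)
  have "weakly_prefers a (V (prefix_of p (anchor n))) (v q)"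
  proof (rule \<sigma>[OF a])
    show "prefix_of q (length (prefix_of p (anchor n))) = prefix_of p (anchor n)"
      using qp by auto
  next
    fix k assume k: "length (prefix_of p (anchor n)) \<le> k" "d (prefix_of q k) = a"
    show "q k = \<sigma> a (prefix_of p (anchor n)) (map q [length (prefix_of p (anchor n))..<k])"
    proof (cases "k < Suc n")
      case True
      have eq: "prefix_of q k = prefix_of p k" "map q [anchor n..<k] = map p [anchor n..<k]"
        using qp True by auto
      have dk: "d (prefix_of p k) = a" using k(2) unfolding eq(1) .
      have "p k = \<sigma> a (prefix_of p (anchor n)) (map p [anchor n..<k])"
      proof (cases "k = n")
        case True
        then show ?thesis using follows_anchor[OF assms] dk by simp
      next
        case False
        then have "k < n" using \<open>k < Suc n\<close> by simp
        then show ?thesis using anchor_invariant[of n] k(1) dk by simp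
      qed
      then show ?thesis
        using qp[OF True] by (simp only: eq(2) length_map length_upt diff_zero)
    next
      case False
      then show ?thesis using f k by (auto simp: drop_map)
    qed
  qed
  then show "weakly_prefers a (V (prefix_of p n)) (v q)" using anchor_invariant[of n] by simp
qed

lemma solution_secures: "weakly_prefers a (V (prefix_of p m)) (v p)"
proof -
  have mono: "weakly_prefers a (V (prefix_of p i)) (V (prefix_of p j))" if "m \<le> i" "i \<le> j" for i j
    using that(2)
  proof (induction rule: dec_induct)
    case base show ?case by (simp add: weakly_prefers_def)
  next
    case (step j)
    then show ?case using weakly_prefers_trans[OF a _ V_step[of j]] V_less that(1) by auto
  qed
  \<comment> \<open>The best value for \<open>a\<close> occurring from \<open>m\<close> on. By
    monotonicity the values stay constant after it is reached.\<close>
  obtain n where n: "n \<ge> m"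
    and max: "\<And>j. j \<ge> m \<Longrightarrow> \<not> gpref G a (V (prefix_of p n)) (V (prefix_of p j))"
    using most_preferred[OF a, of "(\<lambda>n. V (prefix_of p n)) ` {m..}"] V_less by fastforce
  have const: "V (prefix_of p j) = V (prefix_of p n)" if "j \<ge> n" for j
    using mono[OF n that] max[of j] that n by (auto simp: weakly_prefers_def)
  \<comment> \<open>With a constant value and no deviation every move raises the age by one, so the
    anchor stays where it is.\<close>
  have anchor: "anchor j = anchor n" if "j \<ge> n" for j
    using that
  proof (induction rule: dec_induct)
    case (step j)
    have "solution_age a (rev (prefix_of p (Suc j))) = Suc (solution_age a (rev (prefix_of p j)))"
      unfolding solution_age_Suc
      using const[of j] const[of "Suc j"] step follows_anchor[of j] n by auto
    then show ?case using step.IH by (simp only: diff_Suc_Suc)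
  qed simp
  have "weakly_prefers a (V (prefix_of p (anchor n))) (v p)"
  proof (rule \<sigma>[OF a])
    fix k assume k: "length (prefix_of p (anchor n)) \<le> k" "d (prefix_of p k) = a"
    \<comment> \<open>The invariant speaks of positions strictly before its index, hence
      \<open>Suc k\<close>. It also covers moves between the anchor and \<open>m\<close>, where
      following the profile is not assumed.\<close>
    have "anchor (max (Suc k) n) = anchor n" by (rule anchor) simp
    then show "p k = \<sigma> a (prefix_of p (anchor n)) (map p [length (prefix_of p (anchor n))..<k])"
      using anchor_invariant[of "max (Suc k) n"] k by auto
  qed simp
  then have "weakly_prefers a (V (prefix_of p n)) (v p)" using anchor_invariant[of n] by simp
  then show ?thesis using weakly_prefers_trans[OF a mono[OF order.refl n]] V_less v_less by blast
qed

end
end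

theorem spe_solution: "spe G solution"
  unfolding spe_def nash_at_def players
proof (intro allI impI)
  fix hs a s' assume a: "a < 2" and s': "\<forall>h. d h \<noteq> a \<longrightarrow> s' h = solution h"
  have secures: "weakly_prefers b (V hs) (v (play s hs))"
    if "b < 2" "\<And>h. d h = b \<Longrightarrow> s h = solution h" for b s
  proof -
    have "play s hs k = solution (prefix_of (play s hs) k)"
      if "k \<ge> length hs" "d (prefix_of (play s hs) k) = b" for k
      using that \<open>\<And>h. d h = b \<Longrightarrow> s h = solution h\<close> by (subst play_step) simp
    then show ?thesis
      using solution_secures[OF that(1), of "length hs" "play s hs"] by (simp only: play_extends)
  qed
  have "1 - a < 2" "1 - a \<noteq> a" using a by arith+
  \<comment> \<open>Each player secures the value in its own order, so by antisymmetry the outcome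
    is exactly the value.\<close>
  then have "v (play solution hs) = V hs"
    using secures[OF a, of solution] secures[of "1 - a" solution] weakly_prefers_opponent[OF a]
      weakly_prefers_antisym[OF a] V_less v_less by blast
  \<comment> \<open>The opponent of the deviating player still follows \<open>solution\<close> and
    keeps its guarantee.\<close>
  moreover have "weakly_prefers (1 - a) (V hs) (v (play s' hs))"
    using secures[OF \<open>1 - a < 2\<close>] s' \<open>1 - a \<noteq> a\<close> by metis
  ultimately show "\<not> gpref G a (v (play solution hs)) (v (play s' hs))"
    using weakly_prefers_opponent[OF a] pref_asym[OF a] pref_irrefl[OF a] V_less v_less
    unfolding weakly_prefers_def by metis
qed

end

subsection \<open>Codes of words\<close>

text \<open>A left inverse of \<open>word_enc\<close> that reads every number as a word, so that
  every query refers to a history.\<close>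

definition bools :: "nat \<Rightarrow> bool list" where "bools m = map (\<lambda>x. x \<noteq> 0) (list_decode m)"

definition hd_code :: "nat \<Rightarrow> nat" where "hd_code m = fst (prod_decode (m - 1))"

text \<open>Iterates the tail operation on codes. Truncated subtraction and
  \<open>prod_decode 0 = (0, 0)\<close> keep the code 0 of the empty list fixed.\<close>

definition drop_code :: "nat \<Rightarrow> nat \<Rightarrow> nat" where
  "drop_code i m = rec_nat m (\<lambda>_ u. snd (prod_decode (u - 1))) i"

text \<open>Moves the first \<open>i\<close> entries of \<open>m\<close> one by one onto
  \<open>acc\<close>, which reverses them, and normalises each entry to 0 or 1.\<close>

definition rev_append_code :: "nat \<Rightarrow> nat \<Rightarrow> nat \<Rightarrow> nat" where
  "rev_append_code i m acc = rec_nat acc (\<lambda>j u. if drop_code j m = 0 then u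
     else Suc (prod_encode (of_bool (hd_code (drop_code j m) \<noteq> 0), u))) i"

lemma word_enc_simps [simp]: "word_enc [] = 0"
  "word_enc (b # w) = Suc (prod_encode (of_bool b, word_enc w))"
  by (simp_all add: word_enc_def)

lemma bools_word_enc [simp]: "bools (word_enc w) = w"
  by (simp add: bools_def word_enc_def comp_def)

lemma hd_code_Suc [simp]: "hd_code (Suc (prod_encode (x, n))) = x"
  by (simp add: hd_code_def)

lemma drop_code_list_encode: "drop_code i (list_encode l) = list_encode (drop i l)"
proof (induction i)
  case 0 show ?case by (simp add: drop_code_def)
next
  case (Suc i)
  have "prod_decode 0 = (0, 0)" by (simp add: prod_decode_def prod_decode_aux.simps)
  then have "snd (prod_decode (list_encode l' - 1)) = list_encode (tl l')" for l'
    by (cases l') auto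
  then have "drop_code (Suc i) (list_encode l) = list_encode (tl (drop i l))"
    using Suc by (simp add: drop_code_def)
  then show ?case by (simp add: tl_drop drop_Suc)
qed

lemma drop_code_word_enc: "drop_code i (word_enc g) = word_enc (drop i g)"
  by (simp add: word_enc_def drop_code_list_encode drop_map)

lemma rev_append_code: "rev_append_code i m (word_enc w) = word_enc (rev (take i (bools m)) @ w)"
proof (induction i)
  case 0 show ?case by (simp add: rev_append_code_def)
next
  case (Suc i)
  define l where "l = list_decode m"
  have m: "m = list_encode l" by (simp add: l_def)
  have "rev_append_code (Suc i) m (word_enc w) =
    (if drop i l = [] then word_enc (rev (take i (bools m)) @ w)
     else word_enc ((hd (drop i l) \<noteq> 0) # rev (take i (bools m)) @ w))"
    using Suc unfolding m drop_code_list_encode rev_append_code_def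
    by (cases "drop i l") (auto simp: drop_code_list_encode)
  also have "\<dots> = word_enc (rev (take (Suc i) (bools m)) @ w)"
    by (auto simp: bools_def take_Suc_conv_app_nth hd_drop_conv_nth simp flip: l_def)
  finally show ?case .
qed

text \<open>A code bounds the length of its word and can therefore serve as the number of iterations
  needed to process all of it.\<close>

lemma length_bools: "length (bools m) \<le> m"
proof -
  have "length l \<le> list_encode l" for l
  proof (induction l)
    case (Cons x l)
    then show ?case using le_prod_encode_2[of "list_encode l" x] by simp
  qed simp
  from this[of "list_decode m"] show ?thesis by (simp add: bools_def)
qed

lemma rev_append_code_all: "rev_append_code m m (word_enc w) = word_enc (rev (bools m) @ w)"
  using length_bools[of m] by (simp add: rev_append_code)

lemma rev_append_code_0:
  "rev_append_code i (word_enc g) 0 = word_enc (rev (take i g))"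
  "rev_append_code (word_enc g) (word_enc g) 0 = word_enc (rev g)"
  using rev_append_code[of i "word_enc g" "[]"] rev_append_code_all[of "word_enc g" "[]"] by simp_all

lemma computable_hd_code:
  "computable D k A \<Longrightarrow> computable D k (\<lambda>p xs. hd_code (A p xs))"
  unfolding hd_code_def by (rule computable_intros | assumption)+

lemma computable_drop_code:
  assumes "computable D k A" "computable D k B"
  shows "computable D k (\<lambda>p xs. drop_code (A p xs) (B p xs))"
proof (rule computable_comp2[where f = "\<lambda>p. drop_code"])
  show "computable D 2 (\<lambda>p xs. drop_code (arg 0 xs) (arg 1 xs))"
    unfolding drop_code_def by (rule computable_intros)+
qed (rule assms)+

lemma computable_rev_append_code:
  assumes "computable D k A" "computable D k B" "computable D k C"
  shows "computable D k (\<lambda>p xs. rev_append_code (A p xs) (B p xs) (C p xs))"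
proof (rule computable_comp3[where f = "\<lambda>p. rev_append_code"])
  show "computable D 3 (\<lambda>p xs. rev_append_code (arg 0 xs) (arg 1 xs) (arg 2 xs))"
    unfolding rev_append_code_def
    by (rule computable_hd_code computable_drop_code computable_neq0 computable_intros)+
qed (rule assms)+

lemmas computable_word_intros = computable_hd_code computable_drop_code computable_rev_append_code
  computable_neq0 computable_intros

subsection \<open>The outer reduction\<close>

text \<open>An oracle here is a pair of a game and the answers to all queries. A query is coded as
  \<open>(m, c, a)\<close>, where \<open>m\<close> is the code of the reversed history.\<close>

definition turn_of :: "baire \<Rightarrow> nat \<Rightarrow> nat" where
  "turn_of P n = P (2 * prod_encode (1, n))"

definition query_code :: "nat \<Rightarrow> nat \<Rightarrow> nat \<Rightarrow> nat" where
  "query_code m c a = prod_encode (m, prod_encode (c, a))"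

text \<open>The odd half of the oracle holds the answers; its even half comes from Win and its odd
  half from Det.\<close>

definition win_answer :: "baire \<Rightarrow> nat \<Rightarrow> nat \<Rightarrow> nat \<Rightarrow> nat" where
  "win_answer P m c a = P (2 * (2 * prod_encode (query_code m c a, 0)) + 1)"

definition det_answer :: "baire \<Rightarrow> nat \<Rightarrow> nat \<Rightarrow> nat \<Rightarrow> nat \<Rightarrow> nat" where
  "det_answer P m c a n = P (2 * (2 * prod_encode (query_code m c a, n) + 1) + 1)"

definition value_of :: "baire \<Rightarrow> nat \<Rightarrow> nat" where
  "value_of P m = (LEAST c. win_answer P m c 0 = 0 \<and> win_answer P m c 1 = 1)"

text \<open>The recursion of \<open>age\<close> carried out on codes: stage \<open>i\<close> treats
  the suffix of the word of \<open>m\<close> that starts at \<open>m - i\<close>. As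
  \<open>m\<close> bounds the length, stage 0 sees the empty word, and the age remains 0 until the
  suffix becomes nonempty.\<close>

definition age_of :: "baire \<Rightarrow> nat \<Rightarrow> nat \<Rightarrow> nat \<Rightarrow> nat" where
  "age_of P a m i = rec_nat 0 (\<lambda>i u.
     if drop_code (m - Suc i) m = 0 then 0
     else if value_of P (drop_code (m - Suc i) m) = value_of P (drop_code (m - i) m) \<and>
       (\<not> turn_of P (rev_append_code (drop_code (m - i) m) (drop_code (m - i) m) 0) = a \<or>
        (hd_code (drop_code (m - Suc i) m) \<noteq> 0) =
        (det_answer P (drop_code u (drop_code (m - i) m))
           (value_of P (drop_code u (drop_code (m - i) m))) a
           (rev_append_code u (drop_code (m - i) m) 0) \<noteq> 0))
     then Suc u else 0) i"

lemma age_of_Suc: "age_of P a m (Suc i) = (let u = age_of P a m i in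
     if drop_code (m - Suc i) m = 0 then 0
     else if value_of P (drop_code (m - Suc i) m) = value_of P (drop_code (m - i) m) \<and>
       (\<not> turn_of P (rev_append_code (drop_code (m - i) m) (drop_code (m - i) m) 0) = a \<or>
        (hd_code (drop_code (m - Suc i) m) \<noteq> 0) =
        (det_answer P (drop_code u (drop_code (m - i) m))
           (value_of P (drop_code u (drop_code (m - i) m))) a
           (rev_append_code u (drop_code (m - i) m) 0) \<noteq> 0))
     then Suc u else 0)"
  by (simp only: age_of_def Let_def old.nat.simps(7))

definition strategy_of :: "baire \<Rightarrow> nat \<Rightarrow> nat \<Rightarrow> nat \<Rightarrow> nat" where
  "strategy_of P a m u =
     det_answer P (drop_code u m) (value_of P (drop_code u m)) a (rev_append_code u m 0)"

definition outer :: "baire \<Rightarrow> baire" where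
  "outer P n = strategy_of P (turn_of P n) (rev_append_code n n 0)
     (age_of P (turn_of P n) (rev_append_code n n 0) (rev_append_code n n 0))"

section \<open>Computability of the outer reduction\<close>

lemma computable_turn_of: "computable D k A \<Longrightarrow> computable D k (\<lambda>p xs. turn_of p (A p xs))"
  unfolding turn_of_def by (rule computable_intros | assumption)+

lemma computable_det_answer:
  "computable D k A \<Longrightarrow> computable D k B \<Longrightarrow> computable D k C \<Longrightarrow> computable D k E \<Longrightarrow>
   computable D k (\<lambda>p xs. det_answer p (A p xs) (B p xs) (C p xs) (E p xs))"
  unfolding det_answer_def query_code_def by (rule computable_intros | assumption)+

lemma computable_value_of:
  assumes "\<And>P m. P \<in> D \<Longrightarrow> \<exists>c. win_answer P m c 0 = 0 \<and> win_answer P m c 1 = 1"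
    and "computable D k A"
  shows "computable D k (\<lambda>p xs. value_of p (A p xs))"
proof (rule computable_comp1[where f = value_of])
  show "computable D 1 (\<lambda>p xs. value_of p (arg 0 xs))"
    unfolding value_of_def
  proof (rule computable_Least)
    show "computable D (Suc 1) (\<lambda>p ys. of_bool
        (win_answer p (arg 0 (drop 1 ys)) (arg 0 ys) 0 = 0 \<and>
         win_answer p (arg 0 (drop 1 ys)) (arg 0 ys) 1 = 1))"
      unfolding win_answer_def query_code_def by (rule computable_intros)+
  qed (rule assms(1))
qed fact

lemma computable_outer:
  assumes ex: "\<And>P m. P \<in> D \<Longrightarrow> \<exists>c. win_answer P m c 0 = 0 \<and> win_answer P m c 1 = 1"
  shows "computable D 1 (\<lambda>p xs. outer p (arg 0 xs))"
proof -
  note intros = computable_value_of[OF ex] computable_turn_of computable_det_answer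
    computable_word_intros
  have strategy: "computable D k (\<lambda>p xs. strategy_of p (A p xs) (B p xs) (C p xs))"
    if "computable D k A" "computable D k B" "computable D k C" for k A B C
    unfolding strategy_of_def by (rule intros that | assumption)+
  have age3: "computable D 3 (\<lambda>p xs. age_of p (arg 0 xs) (arg 1 xs) (arg 2 xs))"
    unfolding age_of_def by (rule intros | assumption)+
  have age: "computable D k (\<lambda>p xs. age_of p (A p xs) (B p xs) (C p xs))"
    if "computable D k A" "computable D k B" "computable D k C" for k A B C
    by (rule computable_comp3[where f = age_of, OF age3 that])
  show ?thesis
    unfolding outer_def by (rule strategy age intros | assumption)+
qed

lemma age_of_word_enc:
  assumes "i \<le> word_enc g"
  shows "age_of P a (word_enc g) i = age (\<lambda>g. turn_of P (word_enc (rev g))) (\<lambda>g. value_of P (word_enc g))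
      (\<lambda>a g w. det_answer P (word_enc g) (value_of P (word_enc g)) a (word_enc w) \<noteq> 0) a (drop (word_enc g - i) g)"
  using assms
proof (induction i)
  case 0
  have "length g \<le> word_enc g" using length_bools[of "word_enc g"] by simp
  then show ?case by (simp add: age_of_def)
next
  case (Suc i)
  \<comment> \<open>The bound on \<open>Suc i\<close> rules out truncation, so stage
    \<open>i\<close> concerns the suffix from \<open>Suc j\<close> and the next stage the one from
    \<open>j\<close>.\<close>
  define j where "j = word_enc g - Suc i"
  have ji: "word_enc g - i = Suc j" using Suc.prems by (simp add: j_def)
  have IH: "age_of P a (word_enc g) i =
      age (\<lambda>g. turn_of P (word_enc (rev g))) (\<lambda>g. value_of P (word_enc g))
      (\<lambda>a g w. det_answer P (word_enc g) (value_of P (word_enc g)) a (word_enc w) \<noteq> 0) a (drop (Suc j) g)"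
    using Suc.IH[OF Suc_leD[OF Suc.prems]] unfolding ji .
  have unfold: "age_of P a (word_enc g) (Suc i) = (let u = age_of P a (word_enc g) i in
     if word_enc (drop j g) = 0 then 0
     else if value_of P (word_enc (drop j g)) = value_of P (word_enc (drop (Suc j) g)) \<and>
       (turn_of P (word_enc (rev (drop (Suc j) g))) \<noteq> a \<or>
        (hd_code (word_enc (drop j g)) \<noteq> 0) =
        (det_answer P (word_enc (drop u (drop (Suc j) g)))
           (value_of P (word_enc (drop u (drop (Suc j) g)))) a
           (word_enc (rev (take u (drop (Suc j) g)))) \<noteq> 0))
     then Suc u else 0)"
    unfolding age_of_Suc drop_code_word_enc ji j_def[symmetric] rev_append_code_0(2)
    unfolding rev_append_code_0(1) ..
  show ?case
  proof (cases "drop j g")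
    case Nil
    then show ?thesis unfolding unfold j_def[symmetric] Nil by (simp add: Let_def)
  next
    case (Cons b g')
    then have g': "drop (Suc j) g = g'" by (metis drop_Suc list.sel(3) tl_drop)
    show ?thesis
      unfolding unfold j_def[symmetric] IH g' Cons
      by (simp add: Let_def)
  qed
qed

subsection \<open>The inner reduction\<close>

text \<open>The code of the set \<open>upper c a\<close>, summed up from the number of outcomes and
  the preference table stored in the name \<open>x\<close>.\<close>

definition upper_code :: "baire \<Rightarrow> nat \<Rightarrow> nat \<Rightarrow> nat" where
  "upper_code x c a = rec_nat 0 (\<lambda>z u. u +
     (if c < x (prod_encode (0, 1)) \<and> (a = 0 \<and> z = c \<or>
         x (prod_encode (2, prod_encode (0, prod_encode (c, z)))) \<noteq> 0) then 2 ^ z else 0))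
     (x (prod_encode (0, 1)))"

definition upper_name :: "baire \<Rightarrow> nat \<Rightarrow> nat \<Rightarrow> baire" where
  "upper_name x c a = bproj (prod_encode (0, upper_code x c a)) (bproj 3 x)"

definition rescaling_input :: "baire \<Rightarrow> nat \<Rightarrow> baire" where
  "rescaling_input x i = bpair (\<lambda>_. word_enc (rev (bools (fst (prod_decode i)))))
     (upper_name x (fst (prod_decode (snd (prod_decode i)))) (snd (prod_decode (snd (prod_decode i)))))"

text \<open>The win/lose game for query \<open>i\<close>: appending the reversed word to the code
  \<open>j\<close> shifts the turn function to the subgame, and \<open>Y x i\<close> is to name the
  winning set.\<close>

definition query :: "(baire \<Rightarrow> nat \<Rightarrow> baire) \<Rightarrow> baire \<Rightarrow> nat \<Rightarrow> baire" where
  "query Y x i = bpair (\<lambda>j. x (prod_encode (1,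
     rev_append_code (fst (prod_decode i)) (fst (prod_decode i)) j))) (Y x i)"

text \<open>Win and Det receive the same sequence of queries.\<close>

definition inner :: "(baire \<Rightarrow> nat \<Rightarrow> baire) \<Rightarrow> baire \<Rightarrow> baire" where
  "inner Y x = (let q = \<lambda>n. query Y x (fst (prod_decode n)) (snd (prod_decode n)) in bpair q q)"

lemma computable_bpair:
  assumes "computable D k (\<lambda>p xs. f p xs (N p xs div 2))" "computable D k (\<lambda>p xs. g p xs (N p xs div 2))"
    "computable D k N"
  shows "computable D k (\<lambda>p xs. bpair (f p xs) (g p xs) (N p xs))"
  unfolding bpair_def by (rule computable_if computable_even assms)+

lemma computable_inner:
  assumes "\<And>x i. x \<in> D \<Longrightarrow> comp_fun e (rescaling_input x i) (Y x i)"
  shows "computable D 1 (\<lambda>p xs. inner Y p (arg 0 xs))"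
proof -
  have upper: "computable D k (\<lambda>p xs. upper_code p (A p xs) (B p xs))"
    if "computable D k A" "computable D k B" for k A B
  proof (rule computable_comp2[where f = upper_code, OF _ that])
    show "computable D 2 (\<lambda>p xs. upper_code p (arg 0 xs) (arg 1 xs))"
      unfolding upper_code_def by (rule computable_neq0 computable_intros)+
  qed
  have word: "word_enc (rev (bools m)) = rev_append_code m m 0" for m
    using rev_append_code_all[of m "[]"] by simp
  have input: "computable D 2 (\<lambda>p xs. rescaling_input p (arg 1 xs) (arg 0 xs))"
    unfolding rescaling_input_def upper_name_def bproj_def word
    by (rule computable_bpair computable_word_intros upper)+
  show ?thesis
    unfolding inner_def Let_def query_def
    by (rule computable_bpair computable_relativize[OF input assms] computable_word_intros
        | assumption)+
qed

lemma bleft_bpair [simp]: "bleft (bpair p q) = p"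
  and bright_bpair [simp]: "bright (bpair p q) = q"
  by (auto simp: bleft_def bright_def bpair_def)

text \<open>Every input \<open>x\<close> in the domain names a game, but the correctness statements must hold for
  each game named by \<open>x\<close>.\<close>
locale named_game = antagonistic_game +
  fixes gdom :: "baire set" and gnm :: "baire \<Rightarrow> cantor set" and x :: baire
  assumes name: "game_name gdom gnm x G"
begin

lemma d_eq: "x (prod_encode (1, word_enc h)) = d h"
  using name by (simp add: game_name_def bproj_def)

lemma N_eq: "x (prod_encode (0, 1)) = N"
  using name by (simp add: game_name_def bproj_def)

lemma pref_eq: "c < N \<Longrightarrow> z < N \<Longrightarrow>
    x (prod_encode (2, prod_encode (0, prod_encode (c, z)))) \<noteq> 0 \<longleftrightarrow> gpref G 0 c z"
  using name players unfolding game_name_def bproj_def by (metis zero_less_numeral)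

lemma upper_code: "upper_code x c a = set_enc (upper c a)"
proof -
  have "rec_nat 0 (\<lambda>z u. u + f z) n = (\<Sum>z<n. f z)" for f :: "nat \<Rightarrow> nat" and n
    by (induction n) auto
  then have "upper_code x c a = (\<Sum>z<N. if c < N \<and> (a = 0 \<and> z = c \<or>
      x (prod_encode (2, prod_encode (0, prod_encode (c, z)))) \<noteq> 0) then 2 ^ z else 0)"
    unfolding upper_code_def N_eq .
  also have "\<dots> = (\<Sum>z<N. if z \<in> upper c a then 2 ^ z else 0)"
    by (rule sum.cong[OF refl]) (use pref_eq in \<open>auto simp: upper_def\<close>)
  also have "\<dots> = (\<Sum>z\<in>upper c a. 2 ^ z)"
    by (simp add: sum.If_cases, rule sum.cong) (auto simp: upper_def)
  finally show ?thesis by (simp add: set_enc_def)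
qed

lemma upper_name: "upper_name x c a \<in> gdom" "gnm (upper_name x c a) = v -` upper c a"
proof -
  have "upper_name x c a \<in> gdom \<and> gnm (upper_name x c a) = v -` upper c a"
    using name players upper_set_upper[of c a]
    by (simp add: upper_name_def game_name_def upper_code Let_def)
  then show "upper_name x c a \<in> gdom" "gnm (upper_name x c a) = v -` upper c a" by auto
qed

end

locale queried_game = named_game +
  fixes Y :: "baire \<Rightarrow> nat \<Rightarrow> baire"
  assumes Y: "\<And>m c a. Y x (query_code m c a) \<in> gdom"
      "\<And>m c a. gnm (Y x (query_code m c a)) = prepend (rev (bools m)) -` gnm (upper_name x c a)"
begin

lemma inner_components: "bproj i (bleft (inner Y x)) = query Y x i"
    "bproj i (bright (inner Y x)) = query Y x i"
  by (simp_all add: inner_def Let_def bproj_def)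

lemma query: "query Y x (query_code m c a) \<in> wl_dom gdom"
    "wl_of gnm (query Y x (query_code m c a)) = subgame (rev (bools m)) c a"
proof -
  have d: "bleft (query Y x (query_code m c a)) (word_enc w) = d (rev (bools m) @ w)" for w
    by (simp add: query_def query_code_def rev_append_code_all flip: d_eq)
  then show "query Y x (query_code m c a) \<in> wl_dom gdom"
    using Y(1) d_less by (simp add: wl_dom_def query_def)
  show "wl_of gnm (query Y x (query_code m c a)) = subgame (rev (bools m)) c a"
    unfolding wl_of_def d
    by (simp add: query_def Y(2) upper_name subgame_set_def)
qed

lemma in_domain: "inner Y x \<in> pdom (parallel (Win gdom gnm) \<times>\<^sub>W parallel (Det gdom gnm))"
proof -
  \<comment> \<open>Every number is a query code, so all components of the parallel problems are
    legitimate inputs.\<close>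
  have "query Y x i \<in> wl_dom gdom" for i
    using query(1) by (metis prod.collapse prod_decode_inverse query_code_def)
  then show ?thesis
    by (simp add: prob_prod_def parallel_def Win_def Det_def inner_components)
qed

end

locale answered_game = queried_game +
  fixes r :: baire
  assumes r: "psol (parallel (Win gdom gnm) \<times>\<^sub>W parallel (Det gdom gnm)) (inner Y x) r"
begin

abbreviation "P \<equiv> bpair x r"

lemma P_even: "P (2 * n) = x n" and P_odd: "P (2 * n + 1) = r n"
  by (simp_all add: bpair_def)

lemma win_answer: "win_answer P m c a < 2"
    "has_winning_strategy (subgame (rev (bools m)) c a) (win_answer P m c a)"
proof -
  have "win_answer P m c a = bproj (query_code m c a) (bleft r) 0"
    unfolding win_answer_def P_odd by (simp add: bproj_def bleft_def)
  moreover have "psol (Win gdom gnm) (query Y x (query_code m c a)) (bproj (query_code m c a) (bleft r))"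
    using r by (simp add: prob_prod_def parallel_def inner_components)
  ultimately show "win_answer P m c a < 2"
    "has_winning_strategy (subgame (rev (bools m)) c a) (win_answer P m c a)"
    by (simp_all add: Win_def query(2))
qed

lemma det_answer: "nash (subgame (rev (bools m)) c a) (\<lambda>w. det_answer P m c a (word_enc w) \<noteq> 0)"
proof -
  have "det_answer P m c a n = bproj (query_code m c a) (bright r) n" for n
    unfolding det_answer_def P_odd by (simp add: bproj_def bright_def)
  moreover have "psol (Det gdom gnm) (query Y x (query_code m c a)) (bproj (query_code m c a) (bright r))"
    using r by (simp add: prob_prod_def parallel_def inner_components)
  ultimately show ?thesis by (simp add: Det_def query(2) dec_profile_def)
qed

lemma win_answer_value: "\<exists>c. win_answer P m c 0 = 0 \<and> win_answer P m c 1 = 1"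
  by (rule value_exists[OF win_answer])

definition V :: "bool list \<Rightarrow> nat" where "V t = value_of P (word_enc (rev t))"

definition \<sigma> :: "nat \<Rightarrow> bool list \<Rightarrow> bool list \<Rightarrow> bool" where
  "\<sigma> a t w \<longleftrightarrow> det_answer P (word_enc (rev t)) (V t) a (word_enc w) \<noteq> 0"

lemma V_wins:
  assumes "a < 2"
  shows "has_winning_strategy (subgame t (V t) a) a"
proof -
  have "win_answer P (word_enc (rev t)) (V t) 0 = 0 \<and> win_answer P (word_enc (rev t)) (V t) 1 = 1"
    unfolding V_def value_of_def by (rule LeastI_ex) (rule win_answer_value)
  then show ?thesis
    using win_answer(2)[of "word_enc (rev t)" "V t" a] assms by (auto simp: less_2_cases_iff)
qed

text \<open>At the value, player \<open>a\<close> wins the threshold game with flag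
  \<open>a\<close>, so its part of the equilibrium returned by Det is a winning strategy and secures
  the value.\<close>

sublocale solved_game G V \<sigma>
proof unfold_locales
  show "V t < N" for t by (rule value_less[OF V_wins]) simp
  fix a t p
  assume a: "a < 2" and p: "prefix_of p (length t) = t"
    "\<And>k. k \<ge> length t \<Longrightarrow> d (prefix_of p k) = a \<Longrightarrow> p k = \<sigma> a t (map p [length t..<k])"
  have "wins (\<lambda>w. d (t @ w)) (subgame_set t (V t) a) a (\<sigma> a t)"
    using nash_wins[OF _ det_answer V_wins[OF a] a, of "word_enc (rev t)"] d_less
    by (simp add: \<sigma>_def[abs_def])
  then show "weakly_prefers a (V t) (v p)"
    by (rule wins_subgame[OF _ a value_less[OF V_wins] p]) simp_all
qed

text \<open>Running \<open>age_of\<close> for as many stages as the code of the reversed history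
  exhausts the history, so it yields the age used by \<open>solution\<close>.\<close>

lemma outer_solution: "dec_profile (outer P) = solution"
proof
  fix h :: "bool list"
  let ?g = "rev h"
  have turn: "turn_of P (word_enc h) = d h" for h
    unfolding turn_of_def P_even by (rule d_eq)
  have age: "age_of P a (word_enc ?g) (word_enc ?g) = solution_age a ?g" for a
    using age_of_word_enc[OF order.refl, where P = P and a = a and g = ?g]
    unfolding solution_age_def by (simp add: turn V_def \<sigma>_def[abs_def])
  have "outer P (word_enc h) = strategy_of P (d h) (word_enc ?g) (solution_age (d h) ?g)"
    unfolding outer_def turn rev_append_code_0(2) age ..
  then show "dec_profile (outer P) h = solution h"
    by (simp add: dec_profile_def strategy_of_def solution_def Let_def rev_append_code_0(1)
        drop_code_word_enc \<sigma>_def V_def)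
qed

lemma spe_outer: "spe G (dec_profile (outer P))"
  unfolding outer_solution by (rule spe_solution)

end

section \<open>Combining the inner and the outer reduction\<close>

theorem theorem23:
  fixes gdom :: "baire set" and gnm :: "baire \<Rightarrow> cantor set"
  assumes "standing_assumptions gdom gnm"
  shows "SPE gdom gnm \<le>\<^sub>W (parallel (Win gdom gnm) \<times>\<^sub>W parallel (Det gdom gnm))"
proof -
  let ?Q = "parallel (Win gdom gnm) \<times>\<^sub>W parallel (Det gdom gnm)"
  let ?D = "pdom (SPE gdom gnm)"
  \<comment> \<open>Inverse rescaling turns a name of a set of plays into a name of its part after a
    given history.\<close>
  from assms have "\<exists>e. \<forall>w. \<forall>y\<in>gdom. \<exists>z. comp_fun e (bpair (\<lambda>_. word_enc w) y) z \<and>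
      z \<in> gdom \<and> gnm z = prepend w -` gnm y"
    unfolding standing_assumptions_def by (elim conjE)
  then obtain e where e: "\<forall>w. \<forall>y\<in>gdom. \<exists>z. comp_fun e (bpair (\<lambda>_. word_enc w) y) z \<and>
      z \<in> gdom \<and> gnm z = prepend w -` gnm y" ..
  define rescaled where "rescaled x i z \<longleftrightarrow> comp_fun e (rescaling_input x i) z \<and>
      (\<forall>m c a. i = query_code m c a \<longrightarrow>
         z \<in> gdom \<and> gnm z = prepend (rev (bools m)) -` gnm (upper_name x c a))" for x i z
  \<comment> \<open>The names are selected by choice, but the program \<open>e\<close> computes them
    from \<open>rescaling_input x i\<close>.\<close>
  define Y where "Y x i = (SOME z. rescaled x i z)" for x i
  have "rescaled x i (Y x i)" if x: "x \<in> ?D" for x i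
    unfolding Y_def
  proof (rule someI_ex[of "rescaled x i"])
    obtain m c a where i: "i = query_code m c a"
      by (metis prod.collapse prod_decode_inverse query_code_def)
    obtain G where "wf_game G" "antagonistic_linear G" "game_name gdom gnm x G"
      using x by (auto simp: SPE_def)
    then interpret named_game G gdom gnm x by unfold_locales
    obtain z where "comp_fun e (bpair (\<lambda>_. word_enc (rev (bools m))) (upper_name x c a)) z"
      "z \<in> gdom" "gnm z = prepend (rev (bools m)) -` gnm (upper_name x c a)"
      using e upper_name(1)[of c a] by blast
    then show "\<exists>z. rescaled x i z"
      by (intro exI[of _ z]) (simp add: rescaled_def i rescaling_input_def query_code_def)
  qed
  then have Y: "\<And>x i. x \<in> ?D \<Longrightarrow> comp_fun e (rescaling_input x i) (Y x i)"
    "\<And>x m c a. x \<in> ?D \<Longrightarrow> Y x (query_code m c a) \<in> gdom"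
    "\<And>x m c a. x \<in> ?D \<Longrightarrow>
      gnm (Y x (query_code m c a)) = prepend (rev (bools m)) -` gnm (upper_name x c a)"
    by (auto simp: rescaled_def)
  have queried: "queried_game G gdom gnm x Y"
    if "x \<in> ?D" "wf_game G" "antagonistic_linear G" "game_name gdom gnm x G" for x G
    by unfold_locales (use that Y in auto)
  define E where "E = {bpair x r |x r. x \<in> ?D \<and> psol ?Q (inner Y x) r}"
  have "computable ?D 1 (\<lambda>p xs. inner Y p (arg 0 xs))"
    by (rule computable_inner) (rule Y(1))
  from computable_comp_fun[where F = "inner Y", OF this]
  obtain eH where eH: "\<forall>p\<in>?D. comp_fun eH p (inner Y p)" ..
  have "computable E 1 (\<lambda>p xs. outer p (arg 0 xs))"
  proof (rule computable_outer)
    fix p m assume "p \<in> E"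
    then obtain x r where p: "p = bpair x r" and x: "x \<in> ?D" and r: "psol ?Q (inner Y x) r"
      by (auto simp: E_def)
    obtain G where "wf_game G" "antagonistic_linear G" "game_name gdom gnm x G"
      using x by (auto simp: SPE_def)
    then interpret queried_game G gdom gnm x Y using queried x by blast
    interpret answered_game G gdom gnm x Y r by unfold_locales (rule r)
    show "\<exists>c. win_answer p m c 0 = 0 \<and> win_answer p m c 1 = 1"
      unfolding p by (rule win_answer_value)
  qed
  from computable_comp_fun[where F = outer, OF this]
  obtain eK where eK: "\<forall>p\<in>E. comp_fun eK p (outer p)" ..
  show ?thesis
    unfolding weihrauch_le_def
  proof (rule exI[of _ eH], rule exI[of _ eK], intro allI impI ballI)
    fix R x assume R: "realizer ?Q R" and x: "x \<in> ?D"
    have H: "comp_fun eH x (inner Y x)"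
      using eH x ..
    obtain G where "wf_game G" "antagonistic_linear G" "game_name gdom gnm x G"
      using x by (auto simp: SPE_def)
    then have dom: "inner Y x \<in> pdom ?Q" using queried_game.in_domain queried x by blast
    with R have r: "psol ?Q (inner Y x) (R (inner Y x))" by (simp add: realizer_def)
    then have "bpair x (R (inner Y x)) \<in> E" using x by (auto simp: E_def)
    then have K: "comp_fun eK (bpair x (R (inner Y x))) (outer (bpair x (R (inner Y x))))"
      using eK by blast
    have "psol (SPE gdom gnm) x (outer (bpair x (R (inner Y x))))"
      unfolding SPE_def
    proof (simp, intro allI impI)
      \<comment> \<open>The output depends only on \<open>x\<close> and the answers, so the game
        named by \<open>x\<close> can be arbitrary here.\<close>
      fix G assume "wf_game G" "antagonistic_linear G" "game_name gdom gnm x G"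
      then interpret queried_game G gdom gnm x Y using queried x by blast
      interpret answered_game G gdom gnm x Y "R (inner Y x)" by unfold_locales (rule r)
      show "spe G (dec_profile (outer (bpair x (R (inner Y x)))))" by (rule spe_outer)
    qed
    with H dom K show "\<exists>h. comp_fun eH x h \<and> h \<in> pdom ?Q \<and>
        (\<exists>k. comp_fun eK (bpair x (R h)) k \<and> psol (SPE gdom gnm) x k)" by blast
  qed
qed

end
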